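(* Consider the expectile regression model $Y_i=\mu(X_i)+\sigma(X_i)\epsilon_i$, $i=1,\dots,n$, as set up in the context, with $\mu\in\mathcal U$, $\sigma\in\Sigma$, covariate density $h\in\mathcal H$, where the error $\epsilon_i$ follows the asymmetric normal distribution with density $$f(y)=\frac{2}{\sqrt\pi}\,\frac{\sqrt{\phi(1-\phi)}}{\sqrt\phi+\sqrt{1-\phi}}\exp\left[-\phi y^2I(y\ge0)-(1-\phi)y^2I(y<0)\right],\quad y\in\mathbb R,$$ with known $0<\phi<1$. Assume that there exist a density $h_0\in\mathcal H$ and a constant $C<\infty$ such that $\sup_{x\in\mathcal X}h(x)/h_0(x)\le C$ for all $h\in\mathcal H$, and that $M_{h_0}(\varepsilon;\mathcal U)$ is rich and order regular with $M_{h_0}(\varepsilon;\Sigma)=O(M_{h_0}(\varepsilon;\mathcal U))$ as $\varepsilon\to0$. Then the minimax rate of convergence for estimating the expectile regression function $\mu\in\mathcal U$ under the squared $L_2$ distance is $$\inf_{\hat\mu}\ \sup_{\mu\in\mathcal U,\ \sigma\in\Sigma,\ h\in\mathcal H}\mathbb E\|\mu-\hat\mu\|_{2,h}^2\asymp\varepsilon_n^2,$$ where $\varepsilon_n$ is determined by $M_{h_0}(\varepsilon_n;\mathcal U)=n\varepsilon_n^2$, and the infimum is over all estimators based on $(X_i,Y_i)_{i=1}^n$.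
   Context: Model and standing assumptions. The observations $(X_i,Y_i)_{i=1}^n$ are i.i.d. with $Y_i=\mu(X_i)+\sigma(X_i)\epsilon_i$; $X_i$ takes values in $\mathcal X$ and has density $h$ (with respect to a fixed dominating measure written $dx$) belonging to a class $\mathcal H$ of densities; $\epsilon_i$ is independent of $X_i$ and has known density $f$ with respect to Lebesgue measure on $\mathbb R$. The regression function $\mu$ belongs to a class $\mathcal U$ of real functions on $\mathcal X$ with $\sup_{\mu\in\mathcal U}\|\mu\|_\infty<\infty$, which is totally bounded in the $L_2(h_0)$ distance. The scale function $\sigma$ belongs to a class $\Sigma$ of functions on $\mathcal X$ for which there is a fixed $\overline\sigma>1$ with $\overline\sigma^{-1}\le\sigma(x)\le\overline\sigma$ for all $x\in\mathcal X$ and $\sigma\in\Sigma$. The $\phi$-th expectile of a distribution with CDF $F$ is the $z$ with $\int_{-\infty}^z(z-y)\,dF(y)=\phi\int_{-\infty}^\infty|z-y|\,dF(y)$; the $\phi$-th expectile of the asymmetric normal error density $f(y)=\frac{2}{\sqrt\pi}\,\frac{\sqrt{\phi(1-\phi)}}{\sqrt\phi+\sqrt{1-\phi}}\exp\left[-\phi y^2I(y\ge0)-(1-\phi)y^2I(y<0)\right]$, $y\in\mathbb R$, is $0$, so $\mu(x)$ is the conditional $\phi$-th expectile of $Y$ given $X=x$. Notation. $\|\mu-\upsilon\|_{2,h}^2=\int(\mu(x)-\upsilon(x))^2h(x)\,dx$. For nonnegative sequences, $k_n\asymp s_n$ means $k_n=O(s_n)$ and $s_n=O(k_n)$; similarly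 for functions of $\varepsilon\to0$. Metric entropy. For a function class $\mathcal G$, a finite $N_\varepsilon\subset\mathcal G$ is an $\varepsilon$-packing set under $L_2(h_0)$ if $\|g-g'\|_{2,h_0}>\varepsilon$ for all distinct $g,g'\in N_\varepsilon$. $M_{h_0}(\varepsilon;\mathcal G)$ denotes the logarithm of the maximum cardinality of $\varepsilon$-packing sets of $\mathcal G$ under $L_2(h_0)$. As is customary, $M_{h_0}(\varepsilon;\mathcal U)$ is identified with a presumed known order $M(\varepsilon)$ of it (so $M_{h_0}(\varepsilon;\mathcal U)\asymp M(\varepsilon)$ as $\varepsilon\to0$) in the following definitions and in the equation determining $\varepsilon_n$. Rich: for some $0<\alpha<1$, $\liminf_{\varepsilon\to0}M(\alpha\varepsilon)/M(\varepsilon)>1$. Order regular: for every constant $c>0$, $M(\varepsilon)\asymp M(c\varepsilon)$ as $\varepsilon\to0$. *)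

theory Defs
  imports "HOL-Probability.Probability" "HOL-Library.Landau_Symbols"
begin

text \<open>
  Throughout, \<open>\<nu>\<close> is the measure dominating the covariate densities; the covariate space is
  \<open>space \<nu>\<close> with the \<open>\<sigma>\<close>-algebra \<open>sets \<nu>\<close>.
\<close>

definition is_density :: "'a measure \<Rightarrow> ('a \<Rightarrow> real) \<Rightarrow> bool" where
  "is_density \<nu> h \<longleftrightarrow>
     h \<in> borel_measurable \<nu> \<and> (\<forall>x\<in>space \<nu>. 0 \<le> h x) \<and> (\<integral>\<^sup>+ x. ennreal (h x) \<partial>\<nu>) = 1"

text \<open>
  The squared distance takes values in \<open>[0, \<infinity>]\<close> because the loss of an arbitrary estimator may be
  infinite. The real-valued distance is only used on essentially bounded functions, where the
  squared distance is finite.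
\<close>

definition L2_dist_sq :: "'a measure \<Rightarrow> ('a \<Rightarrow> real) \<Rightarrow> ('a \<Rightarrow> real) \<Rightarrow> ('a \<Rightarrow> real) \<Rightarrow> ennreal" where
  "L2_dist_sq \<nu> h g g' = (\<integral>\<^sup>+ x. ennreal ((g x - g' x)\<^sup>2 * h x) \<partial>\<nu>)"

definition L2_dist :: "'a measure \<Rightarrow> ('a \<Rightarrow> real) \<Rightarrow> ('a \<Rightarrow> real) \<Rightarrow> ('a \<Rightarrow> real) \<Rightarrow> real" where
  "L2_dist \<nu> h g g' = sqrt (enn2real (L2_dist_sq \<nu> h g g'))"

definition L2_totally_bounded :: "'a measure \<Rightarrow> ('a \<Rightarrow> real) \<Rightarrow> ('a \<Rightarrow> real) set \<Rightarrow> bool" where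
  "L2_totally_bounded \<nu> h \<G> \<longleftrightarrow>
     (\<forall>e>0. \<exists>K. finite K \<and> K \<subseteq> \<G> \<and> (\<forall>g\<in>\<G>. \<exists>k\<in>K. L2_dist \<nu> h g k < e))"

definition packing_set ::
  "'a measure \<Rightarrow> ('a \<Rightarrow> real) \<Rightarrow> ('a \<Rightarrow> real) set \<Rightarrow> real \<Rightarrow> ('a \<Rightarrow> real) set \<Rightarrow> bool" where
  "packing_set \<nu> h \<G> e N \<longleftrightarrow>
     finite N \<and> N \<subseteq> \<G> \<and> (\<forall>g\<in>N. \<forall>g'\<in>N. g \<noteq> g' \<longrightarrow> L2_dist \<nu> h g g' > e)"

text \<open>The value is \<open>\<infinity>\<close> when the cardinalities of the packing sets are unbounded.\<close>

definition packing_entropy ::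
  "'a measure \<Rightarrow> ('a \<Rightarrow> real) \<Rightarrow> ('a \<Rightarrow> real) set \<Rightarrow> real \<Rightarrow> ennreal" where
  "packing_entropy \<nu> h \<G> e = (SUP N\<in>{N. packing_set \<nu> h \<G> e N}. ennreal (ln (real (card N))))"

definition rich :: "(real \<Rightarrow> real) \<Rightarrow> bool" where
  "rich M \<longleftrightarrow> (\<exists>\<alpha>. 0 < \<alpha> \<and> \<alpha> < 1 \<and> Liminf (at_right 0) (\<lambda>e. ereal (M (\<alpha> * e) / M e)) > 1)"

definition order_regular :: "(real \<Rightarrow> real) \<Rightarrow> bool" where
  "order_regular M \<longleftrightarrow> (\<forall>c>0. M \<in> \<Theta>[at_right 0](\<lambda>e. M (c * e)))"

definition asym_normal_density :: "real \<Rightarrow> real \<Rightarrow> real" where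
  "asym_normal_density \<phi> y =
     2 / sqrt pi * (sqrt (\<phi> * (1 - \<phi>)) / (sqrt \<phi> + sqrt (1 - \<phi>))) *
     exp (- \<phi> * y\<^sup>2 * indicator {0..} y - (1 - \<phi>) * y\<^sup>2 * indicator {..<0} y)"

text \<open>
  The law of one observation \<open>(X, \<mu> X + \<sigma> X * \<epsilon>)\<close>, where \<open>X\<close> has density \<open>h\<close> with respect to \<open>\<nu>\<close>
  and \<open>\<epsilon>\<close> is independent of \<open>X\<close> with Lebesgue density \<open>f\<close>.
\<close>

definition regression_law ::
  "'a measure \<Rightarrow> (real \<Rightarrow> real) \<Rightarrow> ('a \<Rightarrow> real) \<Rightarrow> ('a \<Rightarrow> real) \<Rightarrow> ('a \<Rightarrow> real) \<Rightarrow> ('a \<times> real) measure"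
where
  "regression_law \<nu> f \<mu> \<sigma> h =
     distr (density \<nu> (\<lambda>x. ennreal (h x)) \<Otimes>\<^sub>M density lborel (\<lambda>e. ennreal (f e)))
       (\<nu> \<Otimes>\<^sub>M borel) (\<lambda>(x, e). (x, \<mu> x + \<sigma> x * e))"

text \<open>
  An estimator maps the data \<open>z\<close> and a point \<open>x\<close> to the estimated value at \<open>x\<close>. Joint measurability
  makes the loss and the risk below genuine integrals of measurable functions.
\<close>

definition estimators :: "'a measure \<Rightarrow> nat \<Rightarrow> ((nat \<Rightarrow> 'a \<times> real) \<times> 'a \<Rightarrow> real) set" where
  "estimators \<nu> n = borel_measurable ((\<Pi>\<^sub>M i\<in>{..<n}. \<nu> \<Otimes>\<^sub>M borel) \<Otimes>\<^sub>M \<nu>)"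

definition risk ::
  "'a measure \<Rightarrow> (real \<Rightarrow> real) \<Rightarrow> nat \<Rightarrow> ((nat \<Rightarrow> 'a \<times> real) \<times> 'a \<Rightarrow> real) \<Rightarrow>
   ('a \<Rightarrow> real) \<Rightarrow> ('a \<Rightarrow> real) \<Rightarrow> ('a \<Rightarrow> real) \<Rightarrow> ennreal" where
  "risk \<nu> f n est \<mu> \<sigma> h =
     (\<integral>\<^sup>+ z. L2_dist_sq \<nu> h \<mu> (\<lambda>x. est (z, x)) \<partial>(\<Pi>\<^sub>M i\<in>{..<n}. regression_law \<nu> f \<mu> \<sigma> h))"

definition minimax_risk ::
  "'a measure \<Rightarrow> (real \<Rightarrow> real) \<Rightarrow> ('a \<Rightarrow> real) set \<Rightarrow> ('a \<Rightarrow> real) set \<Rightarrow> ('a \<Rightarrow> real) set \<Rightarrow>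
   nat \<Rightarrow> ennreal" where
  "minimax_risk \<nu> f \<U> \<S> \<H> n =
     (INF est\<in>estimators \<nu> n. SUP (\<mu>, \<sigma>, h)\<in>\<U> \<times> \<S> \<times> \<H>. risk \<nu> f n est \<mu> \<sigma> h)"

definition is_expectile :: "real \<Rightarrow> real measure \<Rightarrow> real \<Rightarrow> bool" where
  "is_expectile \<phi> F z \<longleftrightarrow>
     integrable F (\<lambda>y. z - y) \<and>
     (LINT y:{..z}|F. z - y) = \<phi> * (LINT y|F. \<bar>z - y\<bar>)"

lemma has_bochner_integral_half_gauss:
  assumes "0 < (a::real)"
  shows "has_bochner_integral lborel (\<lambda>x. indicator {0..} x *\<^sub>R (exp (- a * x\<^sup>2) * x)) (1 / (2 * a))"
proof -
  have s: "sqrt a \<noteq> 0" using assms by simp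
  have "has_bochner_integral lborel
     (\<lambda>x. indicator {0..} (0 + sqrt a * x) *\<^sub>R (exp (- (0 + sqrt a * x)\<^sup>2) * (0 + sqrt a * x)))
     ((1 / 2) /\<^sub>R \<bar>sqrt a\<bar>)"
    using lborel_has_bochner_integral_real_affine_iff[OF s, of
        "\<lambda>x. indicator {0..} x *\<^sub>R (exp (- x\<^sup>2) * x)" "1 / 2" 0] gaussian_moment_1 by simp
  then have "has_bochner_integral lborel
     (\<lambda>x. (1 / sqrt a) * (indicator {0..} (0 + sqrt a * x) *\<^sub>R
        (exp (- (0 + sqrt a * x)\<^sup>2) * (0 + sqrt a * x)))) ((1 / sqrt a) * ((1 / 2) /\<^sub>R \<bar>sqrt a\<bar>))"
    by (intro has_bochner_integral_mult_right) auto
  also have "(\<lambda>x. (1 / sqrt a) * (indicator {0..} (0 + sqrt a * x) *\<^sub>R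
        (exp (- (0 + sqrt a * x)\<^sup>2) * (0 + sqrt a * x)))) =
      (\<lambda>x. indicator {0..} x *\<^sub>R (exp (- a * x\<^sup>2) * x))"
    using assms by (intro ext)
      (auto simp: indicator_def power_mult_distrib zero_le_mult_iff)
  also have "(1 / sqrt a) * ((1 / 2) /\<^sub>R \<bar>sqrt a\<bar>) = 1 / (2 * a)"
    using assms by (simp add: field_simps)
  finally show ?thesis .
qed

text \<open>In the regression model \<open>\<mu> x\<close> is the \<open>\<phi>\<close>-th expectile of \<open>Y\<close> given \<open>X = x\<close>.\<close>

lemma is_expectile_asym_normal:
  assumes "0 < \<phi>" "\<phi> < 1" "0 < s"
  shows "is_expectile \<phi>
    (distr (density lborel (\<lambda>e. ennreal (asym_normal_density \<phi> e))) borel (\<lambda>e. m + s * e)) m"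
proof -
  define c where "c = 2 / sqrt pi * (sqrt (\<phi> * (1 - \<phi>)) / (sqrt \<phi> + sqrt (1 - \<phi>)))"
  let ?f = "asym_normal_density \<phi>"
  let ?D = "density lborel (\<lambda>e. ennreal (?f e))"
  have c: "0 \<le> c" using assms by (simp add: c_def)
  have f: "?f e = c * exp (if 0 \<le> e then - \<phi> * e\<^sup>2 else - (1 - \<phi>) * e\<^sup>2)" for e
    unfolding asym_normal_density_def c_def[symmetric]
    by (cases "0 \<le> e") (simp_all add: algebra_simps)
  have f0: "0 \<le> ?f e" for e using c by (simp add: f)
  have [measurable]: "?f \<in> borel_measurable borel"
    unfolding asym_normal_density_def[abs_def] by measurable
  have P: "has_bochner_integral lborel
      (\<lambda>x. (c * s) * (indicator {0..} x *\<^sub>R (exp (- \<phi> * x\<^sup>2) * x))) ((c * s) * (1 / (2 * \<phi>)))"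
    by (intro has_bochner_integral_mult_right has_bochner_integral_half_gauss assms)
  have "has_bochner_integral lborel
      (\<lambda>x. (c * s) * (indicator {0..} x *\<^sub>R (exp (- (1 - \<phi>) * x\<^sup>2) * x)))
      ((c * s) * (1 / (2 * (1 - \<phi>))))"
    by (intro has_bochner_integral_mult_right has_bochner_integral_half_gauss) (use assms in auto)
  from lborel_has_bochner_integral_real_affine_iff[of "-1", THEN iffD1, OF _ this, of 0]
  have "has_bochner_integral lborel
      (\<lambda>x. (c * s) * (indicator {0..} (- x) *\<^sub>R (exp (- (1 - \<phi>) * x\<^sup>2) * (- x))))
      ((c * s) * (1 / (2 * (1 - \<phi>))))" by simp
  also have "(\<lambda>x. (c * s) * (indicator {0..} (- x) *\<^sub>R (exp (- (1 - \<phi>) * x\<^sup>2) * (- x)))) =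
      (\<lambda>x. ?f x * (indicator {..m} (m + s * x) * (m - (m + s * x))))"
    using assms by (intro ext) (auto simp: f indicator_def mult_le_0_iff)
  finally have N: "has_bochner_integral lborel
      (\<lambda>x. ?f x * (indicator {..m} (m + s * x) * (m - (m + s * x))))
      ((c * s) * (1 / (2 * (1 - \<phi>))))" .
  have "(\<lambda>x. (c * s) * (indicator {0..} x *\<^sub>R (exp (- \<phi> * x\<^sup>2) * x)) +
        ?f x * (indicator {..m} (m + s * x) * (m - (m + s * x)))) =
      (\<lambda>x. ?f x * \<bar>m - (m + s * x)\<bar>)"
    using assms by (intro ext)
      (auto simp: f indicator_def mult_le_0_iff abs_mult)
  with has_bochner_integral_add[OF P N]
  have A: "has_bochner_integral lborel (\<lambda>x. ?f x * \<bar>m - (m + s * x)\<bar>)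
      ((c * s) * (1 / (2 * \<phi>)) + (c * s) * (1 / (2 * (1 - \<phi>))))" by simp
  have "integrable lborel (\<lambda>x. ?f x * \<bar>m - (m + s * x)\<bar>)"
    using A by (simp add: has_bochner_integral_iff)
  then have "integrable lborel (\<lambda>x. ?f x * (m - (m + s * x)))"
    by (rule Bochner_Integration.integrable_bound) (auto simp: abs_mult)
  with assms have I: "integrable (distr ?D borel (\<lambda>e. m + s * e)) (\<lambda>y. m - y)"
    by (subst integrable_distr_eq) (auto simp: integrable_density f0 mult.left_commute[of _ s])
  have L: "(LINT y:{..m}|distr ?D borel (\<lambda>e. m + s * e). m - y) = (c * s) * (1 / (2 * (1 - \<phi>)))"
    unfolding set_lebesgue_integral_def
    using N by (subst integral_distr) (auto simp: integral_density f0 has_bochner_integral_iff)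
  have R: "(LINT y|distr ?D borel (\<lambda>e. m + s * e). \<bar>m - y\<bar>) =
      (c * s) * (1 / (2 * \<phi>)) + (c * s) * (1 / (2 * (1 - \<phi>)))"
    using A by (subst integral_distr) (auto simp: integral_density f0 has_bochner_integral_iff)
  show ?thesis
    unfolding is_expectile_def L R using I assms by (auto simp: field_simps)
qed

end

(*
  Lower bound (Yang and Barron). The squared loss asym_sq is smooth enough that the likelihood
  ratio R between two regression functions at L2(h_0) distance at most e has mean at most
  exp (kappa n e^2) under the first law. Testing between a packing at a radius alpha^k eps_n, where
  richness makes the entropy exceed a given multiple of n eps_n^2, is therefore impossible once the
  packing is covered by a net at radius eps_n of much smaller cardinality.

  Upper bound. The loss asym_sq is strongly convex and 0 is the expectile of the error whatever
  the scale, so minimizing the empirical asym_sq over a net of U at radius eps_n attains the rate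
  without estimating sigma or h.
*)
theory Submission
  imports Defs
begin

section \<open>The asymmetric squared loss\<close>

text \<open>Both bounds rest on one estimate, \<open>asym_sq_exp_moment\<close>: the exponential
  moment of a loss difference at shift d is at most 1 + r d^2, with no term linear in d. The loss is
  the negative log density of the error up to a constant. At exponent t = 1 with standardized
  residuals the estimate therefore bounds a chi-square divergence; at a small negative t the
  coefficient r is negative, so a distant candidate is exponentially unlikely to have the smaller
  empirical loss. Averaging over the covariate turns d^2 into a squared L2 distance. The obstacle is
  that the loss is unbounded and the risk is a mean over the data: Gaussian tails supply the
  exponential moments, and x <= a + exp (x - a) converts them into means directly. Richness speaks
  of one ratio M(alpha e) / M(e). Iterated k times it gives a factor y^k, which beats any constant
  at a fixed k, so the packing radius stays a fixed fraction of the net radius and both bounds have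
  the same order.\<close>

definition asym_sq :: "real \<Rightarrow> real \<Rightarrow> real" where
  "asym_sq \<phi> y = (if 0 \<le> y then \<phi> else 1 - \<phi>) * y\<^sup>2"

definition asym_sq_deriv :: "real \<Rightarrow> real \<Rightarrow> real" where
  "asym_sq_deriv \<phi> y = 2 * (if 0 \<le> y then \<phi> else 1 - \<phi>) * y"

lemma measurable_asym_sq [measurable]: "asym_sq \<phi> \<in> borel_measurable borel"
  unfolding asym_sq_def[abs_def] by measurable

lemma measurable_asym_sq_deriv [measurable]: "asym_sq_deriv \<phi> \<in> borel_measurable borel"
  unfolding asym_sq_deriv_def[abs_def] by measurable

lemma measurable_asym_normal_density [measurable]: "asym_normal_density \<phi> \<in> borel_measurable borel"
  unfolding asym_normal_density_def[abs_def] by measurable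

text \<open>With weights a at y and b at y + d, the remainder is a (d^2 - w) + b w for w = (y +
  d)^2. If a = b, then w drops out. Otherwise the step passes 0, so w <= d^2 and the remainder is
  d^2 times a convex combination of a and b.\<close>

lemma asym_sq_remainder:
  assumes "0 < \<phi>" "\<phi> < 1"
  shows "min \<phi> (1 - \<phi>) * d\<^sup>2 \<le> asym_sq \<phi> (y + d) - asym_sq \<phi> y - asym_sq_deriv \<phi> y * d"
    and "asym_sq \<phi> (y + d) - asym_sq \<phi> y - asym_sq_deriv \<phi> y * d \<le> d\<^sup>2"
proof -
  define a b where "a = (if 0 \<le> y then \<phi> else 1 - \<phi>)" and "b = (if 0 \<le> y + d then \<phi> else 1 - \<phi>)"
  define m where "m = min \<phi> (1 - \<phi>)"
  define w where "w = (y + d)\<^sup>2"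
  have alg: "b * (y + d)\<^sup>2 - a * y\<^sup>2 - 2 * a * y * d = a * (d\<^sup>2 - w) + b * w" for a b
    by (simp add: w_def power2_eq_square algebra_simps)
  have eq: "asym_sq \<phi> (y + d) - asym_sq \<phi> y - asym_sq_deriv \<phi> y * d = a * (d\<^sup>2 - w) + b * w"
    unfolding asym_sq_def asym_sq_deriv_def a_def b_def by (rule alg)
  have ab: "m \<le> a" "a \<le> 1" "m \<le> b" "b \<le> 1" using assms by (auto simp: a_def b_def m_def)
  have w0: "0 \<le> w" by (simp add: w_def)
  have "m * d\<^sup>2 \<le> a * (d\<^sup>2 - w) + b * w \<and> a * (d\<^sup>2 - w) + b * w \<le> d\<^sup>2"
  proof (cases "a = b")
    case True
    then have "a * (d\<^sup>2 - w) + b * w = a * d\<^sup>2" by (simp add: algebra_simps)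
    with mult_right_mono[OF ab(1) zero_le_power2[of d]] mult_right_mono[OF ab(2) zero_le_power2[of d]]
    show ?thesis by (simp only: mult_1)
  next
    case False
    then have "\<bar>y + d\<bar> \<le> \<bar>d\<bar>" by (auto simp: a_def b_def split: if_splits)
    then have w: "0 \<le> d\<^sup>2 - w" by (simp add: w_def abs_le_square_iff)
    note mult_right_mono[OF ab(1) w] mult_right_mono[OF ab(2) w]
      mult_right_mono[OF ab(3) w0] mult_right_mono[OF ab(4) w0]
    moreover have "m * d\<^sup>2 = m * (d\<^sup>2 - w) + m * w"
      by (simp only: distrib_left[symmetric] diff_add_cancel)
    ultimately show ?thesis unfolding mult_1 by (intro conjI; linarith)
  qed
  then show "min \<phi> (1 - \<phi>) * d\<^sup>2 \<le> asym_sq \<phi> (y + d) - asym_sq \<phi> y - asym_sq_deriv \<phi> y * d"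
    "asym_sq \<phi> (y + d) - asym_sq \<phi> y - asym_sq_deriv \<phi> y * d \<le> d\<^sup>2"
    unfolding eq m_def[symmetric] by (rule conjunct1, rule conjunct2)
qed

text \<open>Derivative term and remainder are estimated separately. The bound is linear in |y|, so
  exponentials of loss differences are integrable under a Gaussian tail.\<close>

lemma abs_asym_sq_diff_le:
  assumes "0 < \<phi>" "\<phi> < 1"
  shows "\<bar>asym_sq \<phi> (y + d) - asym_sq \<phi> y\<bar> \<le> \<bar>d\<bar> * (2 * \<bar>y\<bar> + \<bar>d\<bar>)"
proof -
  let ?R = "asym_sq \<phi> (y + d) - asym_sq \<phi> y - asym_sq_deriv \<phi> y * d"
  have "0 \<le> min \<phi> (1 - \<phi>) * d\<^sup>2" using assms by (intro mult_nonneg_nonneg) auto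
  then have R: "\<bar>?R\<bar> \<le> \<bar>d\<bar> * \<bar>d\<bar>"
    using asym_sq_remainder[OF assms, where y=y and d=d] by (simp add: power2_eq_square)
  have "\<bar>asym_sq_deriv \<phi> y * d\<bar> = 2 * ((if 0 \<le> y then \<phi> else 1 - \<phi>) * (\<bar>y\<bar> * \<bar>d\<bar>))"
    using assms by (simp add: asym_sq_deriv_def abs_mult)
  also have "\<dots> \<le> 2 * (1 * (\<bar>y\<bar> * \<bar>d\<bar>))"
    using assms by (intro mult_left_mono mult_right_mono) auto
  finally show ?thesis using R by (simp add: algebra_simps)
qed

text \<open>Homogeneity makes the scale harmless: if the derivative has mean 0 at the error, it has
  mean 0 at every positive multiple of the error.\<close>

lemma asym_sq_deriv_scale: "0 < s \<Longrightarrow> asym_sq_deriv \<phi> (s * y) = s * asym_sq_deriv \<phi> y"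
  by (simp add: asym_sq_deriv_def zero_le_mult_iff)

section \<open>The asymmetric normal law: normalization, first-order condition, exponential
  moments\<close>

definition asym_normal_const :: "real \<Rightarrow> real" where
  "asym_normal_const \<phi> = 2 / sqrt pi * (sqrt (\<phi> * (1 - \<phi>)) / (sqrt \<phi> + sqrt (1 - \<phi>)))"

text \<open>Differences of losses at standardized residuals are thereby log-likelihood
  ratios.\<close>

lemma asym_normal_density_eq:
  "asym_normal_density \<phi> y = asym_normal_const \<phi> * exp (- asym_sq \<phi> y)"
  unfolding asym_normal_density_def asym_normal_const_def asym_sq_def
  by (cases "0 \<le> y") (simp_all add: algebra_simps)

lemma asym_normal_const_pos: "0 < \<phi> \<Longrightarrow> \<phi> < 1 \<Longrightarrow> 0 < asym_normal_const \<phi>"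
  unfolding asym_normal_const_def
  by (intro mult_pos_pos divide_pos_pos add_pos_pos) auto

lemma asym_normal_density_pos: "0 < \<phi> \<Longrightarrow> \<phi> < 1 \<Longrightarrow> 0 < asym_normal_density \<phi> y"
  by (simp add: asym_normal_density_eq asym_normal_const_pos)

lemma has_bochner_integral_half_gauss_0:
  assumes "0 < (a::real)"
  shows "has_bochner_integral lborel (\<lambda>x. indicator {0..} x *\<^sub>R exp (- a * x\<^sup>2)) (sqrt pi / (2 * sqrt a))"
proof -
  have s: "sqrt a \<noteq> 0" using assms by simp
  have "has_bochner_integral lborel
     (\<lambda>x. indicator {0..} (0 + sqrt a * x) *\<^sub>R exp (- (0 + sqrt a * x)\<^sup>2)) ((sqrt pi / 2) /\<^sub>R \<bar>sqrt a\<bar>)"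
    using lborel_has_bochner_integral_real_affine_iff[OF s, of
        "\<lambda>x. indicator {0..} x *\<^sub>R exp (- x\<^sup>2)" "sqrt pi / 2" 0] gaussian_moment_0 by simp
  also have "(\<lambda>x. indicator {0..} (0 + sqrt a * x) *\<^sub>R exp (- (0 + sqrt a * x)\<^sup>2)) =
      (\<lambda>x. indicator {0..} x *\<^sub>R exp (- a * x\<^sup>2))"
    using assms by (intro ext) (auto simp: indicator_def power_mult_distrib zero_le_mult_iff)
  finally show ?thesis using assms by (simp add: field_simps)
qed

text \<open>Lets each side of 0 be treated as a half-line integral. Nothing is asked of
  \<open>F\<close> at 0, where both indicators are 1 and the halves would be counted twice; a single
  point is null.\<close>

lemma has_bochner_integral_halves:
  fixes g g' F :: "real \<Rightarrow> real"
  assumes g: "has_bochner_integral lborel (\<lambda>x. indicator {0..} x *\<^sub>R g x) I"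
    and g': "has_bochner_integral lborel (\<lambda>x. indicator {0..} x *\<^sub>R g' x) I'"
    and F: "\<And>x. 0 < x \<Longrightarrow> F x = g x" "\<And>x. x < 0 \<Longrightarrow> F x = g' (- x)"
    and [measurable]: "F \<in> borel_measurable borel"
  shows "has_bochner_integral lborel F (I + I')"
proof -
  have "has_bochner_integral lborel (\<lambda>x. indicator {0..} (- x) *\<^sub>R g' (- x)) I'"
    using lborel_has_bochner_integral_real_affine_iff[of "-1", THEN iffD1, OF _ g', of 0] by simp
  note S = has_bochner_integral_add[OF g this]
  have "AE x in lborel. indicator {0..} x *\<^sub>R g x + indicator {0..} (- x) *\<^sub>R g' (- x) = F x"
    using AE_lborel_singleton[of "0::real"]
  proof eventually_elim
    case (elim x)
    then show ?case by (cases "0 < x") (auto simp: F)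
  qed
  then show ?thesis
    using S by (subst has_bochner_integral_cong_AE[symmetric])
      (auto dest: has_bochner_integral_iff[THEN iffD1] intro: borel_measurable_integrable)
qed

abbreviation asym_normal :: "real \<Rightarrow> real measure" where
  "asym_normal \<phi> \<equiv> density lborel (\<lambda>e. ennreal (asym_normal_density \<phi> e))"

lemma prob_space_asym_normal:
  assumes "0 < \<phi>" "\<phi> < 1"
  shows "prob_space (asym_normal \<phi>)"
proof -
  let ?c = "asym_normal_const \<phi>"
  have e: "(\<phi> - 1) * x\<^sup>2 = - ((1 - \<phi>) * x\<^sup>2)" for x :: real by (simp add: algebra_simps)
  have *: "has_bochner_integral lborel (\<lambda>x. indicator {0..} x *\<^sub>R (?c * exp (- a * x\<^sup>2)))
      (?c * (sqrt pi / (2 * sqrt a)))" if "0 < a" for a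
    using has_bochner_integral_mult_right[OF has_bochner_integral_half_gauss_0[OF that], of ?c]
    by (simp add: mult.left_commute)
  have "has_bochner_integral lborel (asym_normal_density \<phi>)
      (?c * (sqrt pi / (2 * sqrt \<phi>)) + ?c * (sqrt pi / (2 * sqrt (1 - \<phi>))))"
    by (rule has_bochner_integral_halves[OF * *]) (use assms in \<open>auto simp: asym_normal_density_eq asym_sq_def e\<close>)
  moreover have "?c * (sqrt pi / (2 * sqrt \<phi>)) + ?c * (sqrt pi / (2 * sqrt (1 - \<phi>))) = 1"
  proof -
    have "sqrt \<phi> > 0" "sqrt (1 - \<phi>) > 0" "sqrt pi > 0" using assms by auto
    moreover from this have "sqrt \<phi> + sqrt (1 - \<phi>) > 0" by linarith
    ultimately show ?thesis
      unfolding asym_normal_const_def real_sqrt_mult by (simp add: divide_simps)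
  qed
  ultimately have H: "has_bochner_integral lborel (asym_normal_density \<phi>) 1" by simp
  then have "(\<integral>\<^sup>+ e. ennreal (asym_normal_density \<phi> e) \<partial>lborel) = 1"
    using asym_normal_density_pos[OF assms]
    by (subst nn_integral_eq_integral) (auto simp: has_bochner_integral_iff less_imp_le)
  then show ?thesis
    by (intro prob_spaceI) (simp add: emeasure_density)
qed

text \<open>The slope 2 a of the derivative on each side cancels the first moment 1 / (2 a) of exp
  (- a x^2) there, so the two sides contribute opposite multiples of the normalizing
  constant.\<close>

lemma has_bochner_integral_asym_sq_deriv:
  assumes "0 < \<phi>" "\<phi> < 1"
  shows "has_bochner_integral (asym_normal \<phi>) (asym_sq_deriv \<phi>) 0"
proof -
  let ?c = "asym_normal_const \<phi>"
  have e: "(\<phi> - 1) * x\<^sup>2 = - ((1 - \<phi>) * x\<^sup>2)" for x :: real by (simp add: algebra_simps)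
  have *: "has_bochner_integral lborel (\<lambda>x. indicator {0..} x *\<^sub>R (b * (exp (- a * x\<^sup>2) * x)))
      (b * (1 / (2 * a)))" if "0 < a" for a b :: real
    using has_bochner_integral_mult_right[OF has_bochner_integral_half_gauss[OF that], of b]
    by (simp add: mult.left_commute)
  have "has_bochner_integral lborel (\<lambda>e. asym_normal_density \<phi> e *\<^sub>R asym_sq_deriv \<phi> e)
      ((2 * \<phi> * ?c) * (1 / (2 * \<phi>)) + (- 2 * (1 - \<phi>) * ?c) * (1 / (2 * (1 - \<phi>))))"
    by (rule has_bochner_integral_halves[OF * *])
      (use assms in \<open>auto simp: asym_normal_density_eq asym_sq_def asym_sq_deriv_def e\<close>, simp add: algebra_simps)
  also have "(2 * \<phi> * ?c) * (1 / (2 * \<phi>)) + (- 2 * (1 - \<phi>) * ?c) * (1 / (2 * (1 - \<phi>))) = 0"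
    using assms by (simp add: field_simps)
  finally show ?thesis
    using asym_normal_density_pos[OF assms]
    by (intro has_bochner_integral_density) (auto simp: less_imp_le)
qed

lemma integrable_asym_normal_exp_abs:
  assumes "0 < \<phi>" "\<phi> < 1"
  shows "integrable (asym_normal \<phi>) (\<lambda>e. exp (a * \<bar>e\<bar>))"
proof -
  define m where "m = min \<phi> (1 - \<phi>)"
  have m: "0 < m" using assms by (simp add: m_def)
  let ?c = "asym_normal_const \<phi>"
  have "has_bochner_integral lborel (\<lambda>e. exp (- (m / 2) * e\<^sup>2))
      (sqrt pi / (2 * sqrt (m / 2)) + sqrt pi / (2 * sqrt (m / 2)))"
    using has_bochner_integral_half_gauss_0[of "m / 2"] m
    by (intro has_bochner_integral_halves[where g="\<lambda>x. exp (- (m / 2) * x\<^sup>2)"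
          and g'="\<lambda>x. exp (- (m / 2) * x\<^sup>2)"]) auto
  then have "integrable lborel (\<lambda>e. (?c * exp (a\<^sup>2 / (2 * m))) * exp (- (m / 2) * e\<^sup>2))"
    by (simp add: has_bochner_integral_iff)
  then have "integrable lborel (\<lambda>e. asym_normal_density \<phi> e *\<^sub>R exp (a * \<bar>e\<bar>))"
  proof (rule Bochner_Integration.integrable_bound)
    show "AE e in lborel. norm (asym_normal_density \<phi> e *\<^sub>R exp (a * \<bar>e\<bar>))
        \<le> norm ((?c * exp (a\<^sup>2 / (2 * m))) * exp (- (m / 2) * e\<^sup>2))"
    proof (intro AE_I2)
      fix e :: real
      have "m * e\<^sup>2 \<le> asym_sq \<phi> e"
        unfolding asym_sq_def m_def by (intro mult_right_mono) auto
      \<comment> \<open>Completing the square: half of the quadratic decay absorbs the linear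
        exponent, the other half is left for integrability.\<close>
      moreover have "a * \<bar>e\<bar> \<le> a\<^sup>2 / (2 * m) + (m / 2) * e\<^sup>2"
      proof -
        have "0 \<le> (a - m * \<bar>e\<bar>)\<^sup>2 / (2 * m)" using m by simp
        also have "\<dots> = a\<^sup>2 / (2 * m) + (m / 2) * e\<^sup>2 - a * \<bar>e\<bar>"
          using m by (simp add: power2_diff power_mult_distrib field_simps power2_eq_square)
        finally show ?thesis by simp
      qed
      ultimately have "- asym_sq \<phi> e + a * \<bar>e\<bar> \<le> a\<^sup>2 / (2 * m) + - (m / 2) * e\<^sup>2" by linarith
      then have "exp (- asym_sq \<phi> e) * exp (a * \<bar>e\<bar>) \<le> exp (a\<^sup>2 / (2 * m)) * exp (- (m / 2) * e\<^sup>2)"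
        by (simp only: exp_add[symmetric] exp_le_cancel_iff)
      then show "norm (asym_normal_density \<phi> e *\<^sub>R exp (a * \<bar>e\<bar>))
        \<le> norm ((?c * exp (a\<^sup>2 / (2 * m))) * exp (- (m / 2) * e\<^sup>2))"
        using asym_normal_const_pos[OF assms]
        by (simp add: asym_normal_density_eq abs_mult mult.assoc)
    qed
  qed simp
  then show ?thesis
    using asym_normal_density_pos[OF assms]
    by (subst integrable_density) (auto simp: less_imp_le)
qed

text \<open>Two uses of exp a - 1 <= a exp a settle a >= 0; for negative a the second is replaced by
  exp a - 1 >= a. The factor exp |a| makes the bound global, as the exponents here are
  unbounded.\<close>

lemma exp_le_quadratic: "exp (a::real) \<le> 1 + a + a\<^sup>2 * exp \<bar>a\<bar>"
proof -
  have "1 - a \<le> exp (- a)" using exp_ge_add_one_self[of "- a"] by simp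
  then have "(1 - a) * exp a \<le> exp (- a) * exp a" by (intro mult_right_mono) auto
  then have 1: "exp a - 1 \<le> a * exp a" by (simp add: algebra_simps flip: exp_add)
  show ?thesis
  proof (cases "0 \<le> a")
    case True
    then have "a * (exp a - 1) \<le> a * (a * exp a)" using 1 by (intro mult_left_mono)
    then show ?thesis using 1 True by (simp add: algebra_simps power2_eq_square)
  next
    case False
    have "a * (exp a - 1) \<le> a * a"
      using False exp_ge_add_one_self[of a] by (intro mult_left_mono_neg) linarith+
    moreover have "a * a \<le> a * a * exp \<bar>a\<bar>" by (simp add: mult_left_le not_less mult_le_cancel_left1)
    ultimately show ?thesis using 1 by (simp add: algebra_simps power2_eq_square)
  qed
qed

text \<open>The first-order term vanishes because \<open>0\<close> is the expectile of the error.\<close>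

lemma asym_sq_exp_moment:
  assumes \<phi>: "0 < \<phi>" "\<phi> < 1" and D: "0 \<le> D" and S: "0 \<le> S"
  obtains K where "0 \<le> K"
    and "\<And>t d s. \<bar>t\<bar> \<le> 1 \<Longrightarrow> \<bar>d\<bar> \<le> D \<Longrightarrow> 0 < s \<Longrightarrow> s \<le> S \<Longrightarrow>
      (\<integral>\<^sup>+ e. ennreal (exp (t * (asym_sq \<phi> (s * e + d) - asym_sq \<phi> (s * e)))) \<partial>asym_normal \<phi>)
        \<le> ennreal (1 + (max t (min \<phi> (1 - \<phi>) * t) + t\<^sup>2 * K) * d\<^sup>2)"
proof -
  define m where "m = min \<phi> (1 - \<phi>)"
  have m: "0 < m" "m < 1" using \<phi> by (auto simp: m_def)
  \<comment> \<open>\<open>B\<close> is an envelope: for all admissible s and d the loss difference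
    is at most |d| B(e). The second-order term is then at most t^2 d^2 G(e), and one integrable
    \<open>G\<close> serves all t, d, s.\<close>
  define B where "B e = 2 * S * \<bar>e\<bar> + D" for e :: real
  define G where "G e = (B e)\<^sup>2 * exp (D * B e)" for e
  have [measurable]: "G \<in> borel_measurable borel" unfolding G_def[abs_def] B_def[abs_def] by measurable
  have B0: "0 \<le> B e" for e using S D by (simp add: B_def)
  have G0: "0 \<le> G e" for e by (simp add: G_def)
  interpret E: prob_space "asym_normal \<phi>" by (rule prob_space_asym_normal[OF \<phi>])
  have G: "integrable (asym_normal \<phi>) G"
  proof (rule Bochner_Integration.integrable_bound)
    show "integrable (asym_normal \<phi>) (\<lambda>e. exp ((2 + D) * D) * exp (((2 + D) * (2 * S)) * \<bar>e\<bar>))"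
      by (intro integrable_mult_right integrable_asym_normal_exp_abs \<phi>)
    show "AE e in asym_normal \<phi>. norm (G e) \<le> norm (exp ((2 + D) * D) * exp (((2 + D) * (2 * S)) * \<bar>e\<bar>))"
    proof (intro AE_I2)
      fix e
      have "B e \<le> exp (B e)" using exp_ge_add_one_self[of "B e"] by linarith
      then have "(B e)\<^sup>2 \<le> (exp (B e))\<^sup>2" using B0 by (intro power_mono) auto
      then have "G e \<le> (exp (B e))\<^sup>2 * exp (D * B e)" unfolding G_def by (intro mult_right_mono) auto
      also have "\<dots> = exp ((2 + D) * D) * exp (((2 + D) * (2 * S)) * \<bar>e\<bar>)"
        by (simp add: B_def power2_eq_square algebra_simps flip: exp_add)
      finally show "norm (G e) \<le> norm (exp ((2 + D) * D) * exp (((2 + D) * (2 * S)) * \<bar>e\<bar>))"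
        using G0 by simp
    qed
  qed simp
  define K where "K = (LINT e|asym_normal \<phi>. G e)"
  show thesis
  proof (rule that[of K])
    show "0 \<le> K" unfolding K_def by (intro integral_nonneg_AE AE_I2 G0)
    fix t d s :: real
    assume t: "\<bar>t\<bar> \<le> 1" and d: "\<bar>d\<bar> \<le> D" and s: "0 < s" "s \<le> S"
    \<comment> \<open>The remainder of the loss lies between m d^2 and d^2, so t times it is at most
      t d^2 for t >= 0 and m t d^2 for t < 0. As m < 1, the maximum is the one that applies.\<close>
    define r where "r = max t (m * t)"
    let ?Z = "\<lambda>e. asym_sq \<phi> (s * e + d) - asym_sq \<phi> (s * e)"
    let ?H = "\<lambda>e. (1 + r * d\<^sup>2) + (t * s * d) * asym_sq_deriv \<phi> e + (t\<^sup>2 * d\<^sup>2) * G e"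
    have le: "exp (t * ?Z e) \<le> ?H e" for e
    proof -
      have "\<bar>?Z e\<bar> \<le> \<bar>d\<bar> * (2 * \<bar>s * e\<bar> + \<bar>d\<bar>)" by (rule abs_asym_sq_diff_le[OF \<phi>])
      also have "\<dots> \<le> \<bar>d\<bar> * B e" unfolding B_def
        using s d by (intro mult_left_mono add_mono) (auto simp: abs_mult intro!: mult_right_mono)
      finally have Z: "\<bar>?Z e\<bar> \<le> \<bar>d\<bar> * B e" .
      then have "\<bar>?Z e\<bar>\<^sup>2 \<le> (\<bar>d\<bar> * B e)\<^sup>2" by (intro power_mono) auto
      then have Z2: "(?Z e)\<^sup>2 \<le> d\<^sup>2 * (B e)\<^sup>2" by (simp add: power_mult_distrib)
      have "\<bar>t * ?Z e\<bar> \<le> 1 * \<bar>?Z e\<bar>" unfolding abs_mult using t by (intro mult_right_mono) auto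
      also have "\<dots> = \<bar>?Z e\<bar>" by simp
      also note Z
      also have "\<bar>d\<bar> * B e \<le> D * B e" by (rule mult_right_mono[OF d B0])
      finally have tZ: "\<bar>t * ?Z e\<bar> \<le> D * B e" .
      have "(t * ?Z e)\<^sup>2 * exp \<bar>t * ?Z e\<bar> \<le> (t\<^sup>2 * (d\<^sup>2 * (B e)\<^sup>2)) * exp (D * B e)"
        using tZ Z2 by (intro mult_mono) (auto simp: power_mult_distrib intro!: mult_left_mono)
      then have 2: "(t * ?Z e)\<^sup>2 * exp \<bar>t * ?Z e\<bar> \<le> (t\<^sup>2 * d\<^sup>2) * G e" by (simp add: G_def mult.assoc)
      let ?R = "?Z e - asym_sq_deriv \<phi> (s * e) * d"
      have R: "m * d\<^sup>2 \<le> ?R" "?R \<le> d\<^sup>2" unfolding m_def by (rule asym_sq_remainder[OF \<phi>])+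
      have "t * ?R \<le> r * d\<^sup>2"
      proof (cases "0 \<le> t")
        case True
        have "t * ?R \<le> t * d\<^sup>2" using R True by (intro mult_left_mono)
        also have "\<dots> \<le> r * d\<^sup>2" by (intro mult_right_mono) (auto simp: r_def)
        finally show ?thesis .
      next
        case False
        have "t * ?R \<le> t * (m * d\<^sup>2)" using R False by (intro mult_left_mono_neg) auto
        also have "\<dots> = (m * t) * d\<^sup>2" by simp
        also have "\<dots> \<le> r * d\<^sup>2" by (intro mult_right_mono) (auto simp: r_def)
        finally show ?thesis .
      qed
      then have "t * ?Z e \<le> r * d\<^sup>2 + (t * s * d) * asym_sq_deriv \<phi> e"
        using asym_sq_deriv_scale[OF s(1), of \<phi> e] by (simp add: algebra_simps)
      then show ?thesis using exp_le_quadratic[of "t * ?Z e"] 2 by linarith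
    qed
    note I = has_bochner_integral_asym_sq_deriv[OF \<phi>, unfolded has_bochner_integral_iff]
    have int: "integrable (asym_normal \<phi>) ?H"
      using I G by (intro Bochner_Integration.integrable_add integrable_mult_right) auto
    have H0: "0 \<le> ?H e" for e using le[of e] exp_ge_zero[of "t * ?Z e"] by linarith
    have "(\<integral>\<^sup>+ e. ennreal (exp (t * ?Z e)) \<partial>asym_normal \<phi>) \<le> (\<integral>\<^sup>+ e. ennreal (?H e) \<partial>asym_normal \<phi>)"
      using le by (intro nn_integral_mono ennreal_leI)
    also have "\<dots> = ennreal (LINT e|asym_normal \<phi>. ?H e)"
      using int H0 by (intro nn_integral_eq_integral) auto
    also have "(LINT e|asym_normal \<phi>. ?H e) = (1 + r * d\<^sup>2) + t\<^sup>2 * d\<^sup>2 * K"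
      using I G E.prob_space by (simp add: K_def)
    also have "\<dots> = 1 + (r + t\<^sup>2 * K) * d\<^sup>2" by (simp add: algebra_simps)
    finally show "(\<integral>\<^sup>+ e. ennreal (exp (t * ?Z e)) \<partial>asym_normal \<phi>)
        \<le> ennreal (1 + (max t (min \<phi> (1 - \<phi>) * t) + t\<^sup>2 * K) * d\<^sup>2)"
      by (simp add: r_def m_def)
  qed
qed

section \<open>Regression laws\<close>

lemma measurable_is_density [measurable_dest]: "is_density \<nu> h \<Longrightarrow> h \<in> borel_measurable \<nu>"
  by (simp add: is_density_def)

lemma prob_space_is_density:
  assumes "is_density \<nu> h"
  shows "prob_space (density \<nu> (\<lambda>x. ennreal (h x)))"
  using assms by (intro prob_spaceI) (simp add: emeasure_density is_density_def cong: nn_integral_cong)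

lemma AE_is_density:
  assumes "is_density \<nu> h" "AE x in \<nu>. P x"
  shows "AE x in density \<nu> (\<lambda>x. ennreal (h x)). P x"
  using assms by (subst AE_density) (auto simp: is_density_def)

section \<open>Squared L2 distances\<close>

lemma L2_dist_sq_eq:
  assumes [measurable]: "is_density \<nu> h" "g \<in> borel_measurable \<nu>" "g' \<in> borel_measurable \<nu>"
  shows "L2_dist_sq \<nu> h g g' = (\<integral>\<^sup>+ x. ennreal ((g x - g' x)\<^sup>2) \<partial>density \<nu> (\<lambda>x. ennreal (h x)))"
  unfolding L2_dist_sq_def using assms(1)
  by (subst nn_integral_density)
    (auto simp: is_density_def ennreal_mult mult.commute intro!: nn_integral_cong)

lemma L2_dist_sq_commute: "L2_dist_sq \<nu> h g g' = L2_dist_sq \<nu> h g' g"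
  unfolding L2_dist_sq_def by (simp add: power2_commute)

text \<open>Stated for the squared distance, with factor 2, because the middle function will be an
  estimator: its loss may be infinite, and \<open>L2_dist\<close> would then be 0.\<close>

lemma L2_dist_sq_triangle:
  assumes [measurable]: "is_density \<nu> h" "g \<in> borel_measurable \<nu>" "u \<in> borel_measurable \<nu>"
    "g' \<in> borel_measurable \<nu>"
  shows "L2_dist_sq \<nu> h g g' \<le> 2 * (L2_dist_sq \<nu> h g u + L2_dist_sq \<nu> h u g')"
proof -
  have "L2_dist_sq \<nu> h g g' \<le>
      (\<integral>\<^sup>+ x. 2 * (ennreal ((g x - u x)\<^sup>2) + ennreal ((u x - g' x)\<^sup>2)) \<partial>density \<nu> (\<lambda>x. ennreal (h x)))"
    unfolding L2_dist_sq_eq[OF assms(1,2,4)]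
  proof (intro nn_integral_mono)
    fix x
    have "(g x - g' x)\<^sup>2 \<le> 2 * ((g x - u x)\<^sup>2 + (u x - g' x)\<^sup>2)"
      using sum_squares_ge_zero[of "(g x - u x) - (u x - g' x)" 0]
      by (simp add: power2_eq_square algebra_simps)
    then have "ennreal ((g x - g' x)\<^sup>2) \<le> ennreal (2 * ((g x - u x)\<^sup>2 + (u x - g' x)\<^sup>2))"
      by (rule ennreal_leI)
    then show "ennreal ((g x - g' x)\<^sup>2) \<le> 2 * (ennreal ((g x - u x)\<^sup>2) + ennreal ((u x - g' x)\<^sup>2))"
      by (simp add: ennreal_mult)
  qed
  also have "\<dots> = 2 * (L2_dist_sq \<nu> h g u + L2_dist_sq \<nu> h u g')"
    by (simp add: L2_dist_sq_eq[OF assms(1)] nn_integral_cmult nn_integral_add)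
  finally show ?thesis .
qed

text \<open>A bounded difference has a finite squared distance, so \<open>enn2real\<close> inside
  \<open>L2_dist\<close> loses nothing. A bound outside a null set of \<open>\<nu>\<close> suffices,
  since the covariate law is absolutely continuous.\<close>

lemma
  assumes h: "is_density \<nu> h" and [measurable]: "g \<in> borel_measurable \<nu>" "g' \<in> borel_measurable \<nu>"
    and bd: "AE x in \<nu>. \<bar>g x - g' x\<bar> \<le> D"
  shows integrable_sq_diff: "integrable (density \<nu> (\<lambda>x. ennreal (h x))) (\<lambda>x. (g x - g' x)\<^sup>2)"
    and L2_dist_power2: "(L2_dist \<nu> h g g')\<^sup>2 = (LINT x|density \<nu> (\<lambda>x. ennreal (h x)). (g x - g' x)\<^sup>2)"
    and L2_dist_sq_bounded: "L2_dist_sq \<nu> h g g' = ennreal ((L2_dist \<nu> h g g')\<^sup>2)"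
proof -
  interpret X: prob_space "density \<nu> (\<lambda>x. ennreal (h x))" by (rule prob_space_is_density[OF h])
  show int: "integrable (density \<nu> (\<lambda>x. ennreal (h x))) (\<lambda>x. (g x - g' x)\<^sup>2)"
  proof (rule X.integrable_const_bound[where B="D\<^sup>2"])
    show "AE x in density \<nu> (\<lambda>x. ennreal (h x)). norm ((g x - g' x)\<^sup>2) \<le> D\<^sup>2"
      using AE_is_density[OF h bd] by eventually_elim (simp add: abs_le_square_iff[symmetric])
  qed simp
  have eq: "L2_dist_sq \<nu> h g g' = ennreal (LINT x|density \<nu> (\<lambda>x. ennreal (h x)). (g x - g' x)\<^sup>2)"
    unfolding L2_dist_sq_eq[OF h assms(2,3)] using int by (intro nn_integral_eq_integral) auto
  show sq: "(L2_dist \<nu> h g g')\<^sup>2 = (LINT x|density \<nu> (\<lambda>x. ennreal (h x)). (g x - g' x)\<^sup>2)"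
    unfolding L2_dist_def by (simp add: eq integral_nonneg_AE)
  show "L2_dist_sq \<nu> h g g' = ennreal ((L2_dist \<nu> h g g')\<^sup>2)" unfolding sq by (rule eq)
qed

section \<open>The law of one observation and of independent observations\<close>

lemma sets_regression_law [simp, measurable_cong]:
  "sets (regression_law \<nu> f \<mu> \<sigma> h) = sets (\<nu> \<Otimes>\<^sub>M borel)"
  by (simp add: regression_law_def)

lemma space_regression_law [simp]:
  "space (regression_law \<nu> f \<mu> \<sigma> h) = space (\<nu> \<Otimes>\<^sub>M borel)"
  by (simp add: regression_law_def)

lemma measurable_regression_map:
  fixes \<mu> \<sigma> :: "'a \<Rightarrow> real"
  assumes [measurable]: "\<mu> \<in> borel_measurable \<nu>" "\<sigma> \<in> borel_measurable \<nu>"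
  shows "(\<lambda>(x, e). (x, \<mu> x + \<sigma> x * e)) \<in>
    density \<nu> (\<lambda>x. ennreal (h x)) \<Otimes>\<^sub>M density lborel (\<lambda>e. ennreal (f e)) \<rightarrow>\<^sub>M \<nu> \<Otimes>\<^sub>M borel"
proof -
  have "(\<lambda>z. (fst z, \<mu> (fst z) + \<sigma> (fst z) * snd z)) \<in> \<nu> \<Otimes>\<^sub>M (borel :: real measure) \<rightarrow>\<^sub>M \<nu> \<Otimes>\<^sub>M borel"
    by (intro measurable_Pair measurable_fst borel_measurable_add borel_measurable_times measurable_snd
        measurable_compose[OF measurable_fst assms(1)] measurable_compose[OF measurable_fst assms(2)])
  then show ?thesis by (simp add: split_beta' cong: measurable_cong_sets)
qed

lemma prob_space_regression_law:
  assumes "is_density \<nu> h" "prob_space (density lborel (\<lambda>e. ennreal (f e)))"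
    and "\<mu> \<in> borel_measurable \<nu>" "\<sigma> \<in> borel_measurable \<nu>"
  shows "prob_space (regression_law \<nu> f \<mu> \<sigma> h)"
proof -
  interpret X: prob_space "density \<nu> (\<lambda>x. ennreal (h x))" by (rule prob_space_is_density[OF assms(1)])
  interpret E: prob_space "density lborel (\<lambda>e. ennreal (f e))" by fact
  interpret XE: pair_prob_space "density \<nu> (\<lambda>x. ennreal (h x))" "density lborel (\<lambda>e. ennreal (f e))" ..
  show ?thesis
    unfolding regression_law_def by (rule XE.prob_space_distr[OF measurable_regression_map[OF assms(3,4)]])
qed

lemma nn_integral_regression_law:
  assumes "prob_space (density lborel (\<lambda>e. ennreal (f e)))"
    and [measurable]: "\<mu> \<in> borel_measurable \<nu>" "\<sigma> \<in> borel_measurable \<nu>"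
    "g \<in> borel_measurable (\<nu> \<Otimes>\<^sub>M borel)"
  shows "(\<integral>\<^sup>+ z. g z \<partial>regression_law \<nu> f \<mu> \<sigma> h) =
    (\<integral>\<^sup>+ x. \<integral>\<^sup>+ e. g (x, \<mu> x + \<sigma> x * e) \<partial>density lborel (\<lambda>e. ennreal (f e)) \<partial>density \<nu> (\<lambda>x. ennreal (h x)))"
proof -
  interpret E: prob_space "density lborel (\<lambda>e. ennreal (f e))" by fact
  have "(\<integral>\<^sup>+ z. g z \<partial>regression_law \<nu> f \<mu> \<sigma> h) =
    (\<integral>\<^sup>+ (x, e). g (x, \<mu> x + \<sigma> x * e)
      \<partial>(density \<nu> (\<lambda>x. ennreal (h x)) \<Otimes>\<^sub>M density lborel (\<lambda>e. ennreal (f e))))"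
    unfolding regression_law_def
    by (subst nn_integral_distr[OF measurable_regression_map]) (auto simp: split_beta' intro!: nn_integral_cong)
  also have "\<dots> = (\<integral>\<^sup>+ x. \<integral>\<^sup>+ e. g (x, \<mu> x + \<sigma> x * e)
      \<partial>density lborel (\<lambda>e. ennreal (f e)) \<partial>density \<nu> (\<lambda>x. ennreal (h x)))"
    by (subst E.nn_integral_fst[symmetric]) (auto simp: split_beta')
  finally show ?thesis .
qed

text \<open>Given x, the two laws differ by translating the error by t = (mu x - u x) / sigma x, and
  Lebesgue measure is translation invariant. The covariate density and the Jacobian of the scale are
  common to both laws and cancel.\<close>

lemma regression_law_density:
  assumes f: "\<And>e. 0 < f e" "f \<in> borel_measurable borel" "prob_space (density lborel (\<lambda>e. ennreal (f e)))"
    and [measurable]: "\<mu> \<in> borel_measurable \<nu>" "u \<in> borel_measurable \<nu>" "\<sigma> \<in> borel_measurable \<nu>"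
    and \<sigma>: "\<And>x. x \<in> space \<nu> \<Longrightarrow> 0 < \<sigma> x"
  shows "regression_law \<nu> f \<mu> \<sigma> h =
    density (regression_law \<nu> f u \<sigma> h)
      (\<lambda>z. ennreal (f ((snd z - \<mu> (fst z)) / \<sigma> (fst z)) / f ((snd z - u (fst z)) / \<sigma> (fst z))))"
    (is "?L = density ?Q ?R")
proof (rule measure_eqI)
  note [measurable] = f(2)
  fix A assume "A \<in> sets ?L"
  then have A[measurable]: "A \<in> sets (\<nu> \<Otimes>\<^sub>M borel)" by simp
  have R[measurable]: "?R \<in> borel_measurable (\<nu> \<Otimes>\<^sub>M borel)" by measurable
  have "emeasure ?L A = (\<integral>\<^sup>+ z. indicator A z \<partial>?L)" by simp
  also have "\<dots> = (\<integral>\<^sup>+ x. \<integral>\<^sup>+ e. indicator A (x, \<mu> x + \<sigma> x * e) \<partial>density lborel (\<lambda>e. ennreal (f e))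
      \<partial>density \<nu> (\<lambda>x. ennreal (h x)))"
    by (rule nn_integral_regression_law[OF f(3)]) auto
  also have "\<dots> = (\<integral>\<^sup>+ x. \<integral>\<^sup>+ e. ?R (x, u x + \<sigma> x * e) * indicator A (x, u x + \<sigma> x * e)
      \<partial>density lborel (\<lambda>e. ennreal (f e)) \<partial>density \<nu> (\<lambda>x. ennreal (h x)))"
  proof (rule nn_integral_cong)
    fix x assume "x \<in> space (density \<nu> (\<lambda>x. ennreal (h x)))"
    then have x[measurable]: "x \<in> space \<nu>" by simp
    define t where "t = (\<mu> x - u x) / \<sigma> x"
    have "(\<integral>\<^sup>+ e. ?R (x, u x + \<sigma> x * e) * indicator A (x, u x + \<sigma> x * e) \<partial>density lborel (\<lambda>e. ennreal (f e)))
      = (\<integral>\<^sup>+ e. ennreal (f e) * (?R (x, u x + \<sigma> x * e) * indicator A (x, u x + \<sigma> x * e)) \<partial>lborel)"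
      by (rule nn_integral_density) measurable
    also have "\<dots> = (\<integral>\<^sup>+ e. ennreal (f (e - t)) * indicator A (x, u x + \<sigma> x * e) \<partial>lborel)"
    proof (intro nn_integral_cong)
      fix e
      have "(u x + \<sigma> x * e - \<mu> x) / \<sigma> x = e - t" "(u x + \<sigma> x * e - u x) / \<sigma> x = e"
        using \<sigma>[OF x] by (auto simp: t_def field_simps)
      then have "ennreal (f e) * ?R (x, u x + \<sigma> x * e) = ennreal (f (e - t))"
        using f(1)[of e] f(1)[of "e - t"] by (simp add: ennreal_mult'[symmetric] less_imp_le)
      then show "ennreal (f e) * (?R (x, u x + \<sigma> x * e) * indicator A (x, u x + \<sigma> x * e)) =
          ennreal (f (e - t)) * indicator A (x, u x + \<sigma> x * e)"
        by (simp only: mult.assoc[symmetric])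
    qed
    also have "\<dots> = ennreal \<bar>1\<bar> * (\<integral>\<^sup>+ e. ennreal (f ((t + 1 * e) - t)) * indicator A (x, u x + \<sigma> x * (t + 1 * e)) \<partial>lborel)"
      by (rule nn_integral_real_affine) measurable
    also have "\<dots> = (\<integral>\<^sup>+ e. ennreal (f e) * indicator A (x, \<mu> x + \<sigma> x * e) \<partial>lborel)"
    proof -
      have "u x + \<sigma> x * (t + e) = \<mu> x + \<sigma> x * e" for e
        using \<sigma>[OF x] by (simp add: t_def field_simps)
      then show ?thesis by simp
    qed
    also have "\<dots> = (\<integral>\<^sup>+ e. indicator A (x, \<mu> x + \<sigma> x * e) \<partial>density lborel (\<lambda>e. ennreal (f e)))"
      by (rule nn_integral_density[symmetric]) measurable
    finally show "(\<integral>\<^sup>+ e. indicator A (x, \<mu> x + \<sigma> x * e) \<partial>density lborel (\<lambda>e. ennreal (f e))) =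
        (\<integral>\<^sup>+ e. ?R (x, u x + \<sigma> x * e) * indicator A (x, u x + \<sigma> x * e) \<partial>density lborel (\<lambda>e. ennreal (f e)))"
      by simp
  qed
  also have "\<dots> = (\<integral>\<^sup>+ z. ?R z * indicator A z \<partial>?Q)"
    by (rule nn_integral_regression_law[OF f(3), symmetric]) measurable
  also have "\<dots> = emeasure (density ?Q ?R) A"
    by (rule emeasure_density[symmetric]) measurable
  finally show "emeasure ?L A = emeasure (density ?Q ?R) A" .
qed simp

lemma nn_integral_PiM_exp_sum:
  fixes q :: "'a \<Rightarrow> real"
  assumes "prob_space P" and [measurable]: "q \<in> borel_measurable P"
  shows "(\<integral>\<^sup>+ z. ennreal (exp (\<Sum>i<n. q (z i))) \<partial>(\<Pi>\<^sub>M i\<in>{..<n}. P)) = (\<integral>\<^sup>+ z. ennreal (exp (q z)) \<partial>P) ^ n"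
proof -
  interpret P: prob_space P by fact
  interpret product_sigma_finite "\<lambda>_::nat. P" ..
  have "(\<integral>\<^sup>+ z. (\<Prod>i<n. ennreal (exp (q (z i)))) \<partial>(\<Pi>\<^sub>M i\<in>{..<n}. P)) = (\<Prod>i<n. \<integral>\<^sup>+ z. ennreal (exp (q z)) \<partial>P)"
    by (rule product_nn_integral_prod) auto
  then show ?thesis by (simp add: exp_sum prod_ennreal)
qed

lemma PiM_density:
  assumes "prob_space P" "prob_space (density P R)" "finite I" and [measurable]: "R \<in> borel_measurable P"
  shows "(\<Pi>\<^sub>M i\<in>I. density P R) = density (\<Pi>\<^sub>M i\<in>I. P) (\<lambda>z. \<Prod>i\<in>I. R (z i))"
proof -
  interpret P: prob_space P by fact
  interpret PR: prob_space "density P R" by fact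
  interpret P: product_sigma_finite "\<lambda>_. P" ..
  interpret PR: product_sigma_finite "\<lambda>_. density P R" ..
  note [simp] = \<open>finite I\<close>
  have [measurable]: "(\<lambda>z. \<Prod>i\<in>I. R (z i)) \<in> borel_measurable (\<Pi>\<^sub>M i\<in>I. P)"
    by (intro borel_measurable_prod_ennreal) measurable
  show ?thesis
  proof (rule PR.PiM_eqI[symmetric])
    show "sets (density (\<Pi>\<^sub>M i\<in>I. P) (\<lambda>z. \<Prod>i\<in>I. R (z i))) = sets (\<Pi>\<^sub>M i\<in>I. density P R)"
      by (simp cong: sets_PiM_cong)
    fix A assume "\<And>i. i \<in> I \<Longrightarrow> A i \<in> sets (density P R)"
    then have A[measurable]: "\<And>i. i \<in> I \<Longrightarrow> A i \<in> sets P" by simp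
    have "emeasure (density (\<Pi>\<^sub>M i\<in>I. P) (\<lambda>z. \<Prod>i\<in>I. R (z i))) (Pi\<^sub>E I A) =
        (\<integral>\<^sup>+ z. (\<Prod>i\<in>I. R (z i)) * indicator (Pi\<^sub>E I A) z \<partial>(\<Pi>\<^sub>M i\<in>I. P))"
      using A by (intro emeasure_density) (auto intro: sets_PiM_I_finite)
    also have "\<dots> = (\<integral>\<^sup>+ z. (\<Prod>i\<in>I. R (z i) * indicator (A i) (z i)) \<partial>(\<Pi>\<^sub>M i\<in>I. P))"
    proof (intro nn_integral_cong)
      fix z assume "z \<in> space (\<Pi>\<^sub>M i\<in>I. P)"
      then have "indicator (Pi\<^sub>E I A) z = (\<Prod>i\<in>I. indicator (A i) (z i) :: ennreal)"
        by (auto simp: space_PiM PiE_iff indicator_def prod_zero_iff)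
      then show "(\<Prod>i\<in>I. R (z i)) * indicator (Pi\<^sub>E I A) z = (\<Prod>i\<in>I. R (z i) * indicator (A i) (z i))"
        by (simp add: prod.distrib)
    qed
    also have "\<dots> = (\<Prod>i\<in>I. \<integral>\<^sup>+ z. R z * indicator (A i) z \<partial>P)"
      by (rule P.product_nn_integral_prod) auto
    also have "\<dots> = (\<Prod>i\<in>I. emeasure (density P R) (A i))"
      by (intro prod.cong refl) (simp add: emeasure_density)
    finally show "emeasure (density (\<Pi>\<^sub>M i\<in>I. P) (\<lambda>z. \<Prod>i\<in>I. R (z i))) (Pi\<^sub>E I A) =
        (\<Prod>i\<in>I. emeasure (density P R) (A i))" .
  qed simp
qed

text \<open>The mean of 1 + r (mu - u)^2 over the covariate is at most the exponential of r times
  the squared distance, and independence gives the power n. For negative r the assumption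
  \<open>0 \<le> 1 + r * D\<^sup>2\<close> keeps the integrand nonnegative, since
  \<open>ennreal\<close> cuts negative values off at 0.\<close>

lemma regression_law_exp_moment:
  fixes q :: "'a \<times> real \<Rightarrow> real"
  assumes h: "is_density \<nu> h" and f: "prob_space (density lborel (\<lambda>e. ennreal (f e)))"
    and [measurable]: "\<mu> \<in> borel_measurable \<nu>" "u \<in> borel_measurable \<nu>" "\<sigma> \<in> borel_measurable \<nu>"
      "q \<in> borel_measurable (\<nu> \<Otimes>\<^sub>M borel)"
    and bd: "AE x in \<nu>. \<bar>\<mu> x - u x\<bar> \<le> D"
    and r: "0 \<le> 1 + r * D\<^sup>2"
    and q: "\<And>x. x \<in> space \<nu> \<Longrightarrow> \<bar>\<mu> x - u x\<bar> \<le> D \<Longrightarrow>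
      (\<integral>\<^sup>+ e. ennreal (exp (q (x, \<mu> x + \<sigma> x * e))) \<partial>density lborel (\<lambda>e. ennreal (f e)))
        \<le> ennreal (1 + r * (\<mu> x - u x)\<^sup>2)"
  shows "(\<integral>\<^sup>+ z. ennreal (exp (\<Sum>i<n. q (z i))) \<partial>(\<Pi>\<^sub>M i\<in>{..<n}. regression_law \<nu> f \<mu> \<sigma> h))
    \<le> ennreal (exp (real n * (r * (L2_dist \<nu> h \<mu> u)\<^sup>2)))"
proof -
  interpret X: prob_space "density \<nu> (\<lambda>x. ennreal (h x))" by (rule prob_space_is_density[OF h])
  let ?X = "density \<nu> (\<lambda>x. ennreal (h x))"
  note int = integrable_sq_diff[OF h _ _ bd] and sq = L2_dist_power2[OF h _ _ bd]
  have "(\<integral>\<^sup>+ z. ennreal (exp (q z)) \<partial>regression_law \<nu> f \<mu> \<sigma> h) =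
    (\<integral>\<^sup>+ x. \<integral>\<^sup>+ e. ennreal (exp (q (x, \<mu> x + \<sigma> x * e))) \<partial>density lborel (\<lambda>e. ennreal (f e)) \<partial>?X)"
    by (rule nn_integral_regression_law[OF f]) auto
  also have "\<dots> \<le> (\<integral>\<^sup>+ x. ennreal (1 + r * (\<mu> x - u x)\<^sup>2) \<partial>?X)"
  proof (rule nn_integral_mono_AE)
    show "AE x in ?X. (\<integral>\<^sup>+ e. ennreal (exp (q (x, \<mu> x + \<sigma> x * e))) \<partial>density lborel (\<lambda>e. ennreal (f e)))
        \<le> ennreal (1 + r * (\<mu> x - u x)\<^sup>2)"
      using AE_is_density[OF h bd] AE_space by eventually_elim (auto intro: q)
  qed
  also have "\<dots> = ennreal (LINT x|?X. 1 + r * (\<mu> x - u x)\<^sup>2)"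
  proof (intro nn_integral_eq_integral)
    show "AE x in ?X. 0 \<le> 1 + r * (\<mu> x - u x)\<^sup>2"
      using AE_is_density[OF h bd]
    proof eventually_elim
      case (elim x)
      then have "(\<mu> x - u x)\<^sup>2 \<le> D\<^sup>2" using power_mono[OF elim, of 2] by simp
      then show ?case
        using r mult_left_mono_neg[of "(\<mu> x - u x)\<^sup>2" "D\<^sup>2" r] 
        by (cases "0 \<le> r") (simp, linarith)
    qed
  qed (use int in auto)
  also have "(LINT x|?X. 1 + r * (\<mu> x - u x)\<^sup>2) = 1 + r * (L2_dist \<nu> h \<mu> u)\<^sup>2"
    using int X.prob_space by (simp add: sq)
  also have "ennreal \<dots> \<le> ennreal (exp (r * (L2_dist \<nu> h \<mu> u)\<^sup>2))"
    by (intro ennreal_leI exp_ge_add_one_self)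
  finally have "(\<integral>\<^sup>+ z. ennreal (exp (q z)) \<partial>regression_law \<nu> f \<mu> \<sigma> h) ^ n \<le>
      ennreal (exp (r * (L2_dist \<nu> h \<mu> u)\<^sup>2)) ^ n"
    by (rule power_mono) simp
  then show ?thesis
    by (subst nn_integral_PiM_exp_sum[OF prob_space_regression_law[OF h f]])
      (auto simp: ennreal_power exp_of_nat_mult)
qed

section \<open>Lower bound\<close>

text \<open>
  Fano's method with \<open>\<chi>\<^sup>2\<close>-divergences: integrating \<open>R \<le> R\<^sup>2 / (4 T) + T\<close> over \<open>A \<theta>\<close> bounds
  \<open>P \<theta> (A \<theta>)\<close> by \<open>1/4 + T P j (A \<theta>)\<close>, and the sets \<open>A \<theta>\<close> are disjoint.
\<close>

lemma multiple_testing_bound: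
  fixes P :: "'b \<Rightarrow> 'c measure" and T :: real
  assumes fin: "finite N" "finite J" and T: "0 < T"
    and P: "\<And>j. j \<in> J \<Longrightarrow> prob_space (P j)" "\<And>j. j \<in> J \<Longrightarrow> sets (P j) = sets M"
    and near: "\<And>\<theta>. \<theta> \<in> N \<Longrightarrow> \<exists>j\<in>J. \<exists>R\<in>borel_measurable M.
      P \<theta> = density (P j) R \<and> (\<integral>\<^sup>+ z. R z \<partial>P \<theta>) \<le> ennreal T"
    and A: "\<And>\<theta>. \<theta> \<in> N \<Longrightarrow> A \<theta> \<in> sets M" "disjoint_family_on A N"
  shows "(\<Sum>\<theta>\<in>N. emeasure (P \<theta>) (A \<theta>)) \<le> ennreal (real (card N) / 4 + T * real (card J))"
proof -
  have 1: "emeasure (P \<theta>) (A \<theta>) \<le> ennreal (1 / 4) + ennreal T * (\<Sum>j\<in>J. emeasure (P j) (A \<theta>))"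
    if \<theta>: "\<theta> \<in> N" for \<theta>
  proof -
    obtain j R where j: "j \<in> J" and R: "R \<in> borel_measurable M" "P \<theta> = density (P j) R"
      "(\<integral>\<^sup>+ z. R z \<partial>P \<theta>) \<le> ennreal T" using near[OF \<theta>] by auto
    note s = P(2)[OF j]
    have R'[measurable]: "R \<in> borel_measurable (P j)"
      using R(1) by (simp add: measurable_cong_sets[OF s refl])
    have A'[measurable]: "A \<theta> \<in> sets (P j)" using A(1)[OF \<theta>] s by simp
    \<comment> \<open>This is (r - 2 T)^2 >= 0. The multiple 1 / (4 T) is tuned to the bound T on
      the mean of R under \<open>P \<theta>\<close>, leaving 1/4.\<close>
    have pw: "R z \<le> ennreal (1 / (4 * T)) * (R z * R z) + ennreal T" for z
    proof (cases "R z")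
      case (real r)
      have "r \<le> 1 / (4 * T) * (r * r) + T"
        using sum_squares_ge_zero[of "r - 2 * T" 0] T by (simp add: field_simps)
      then show ?thesis using real T by (simp add: ennreal_mult''[symmetric] ennreal_plus[symmetric] del: ennreal_plus)
    next
      case top
      then show ?thesis using T by (simp add: ennreal_mult_top ennreal_top_mult)
    qed
    have "emeasure (P \<theta>) (A \<theta>) = (\<integral>\<^sup>+ z. R z * indicator (A \<theta>) z \<partial>P j)"
      unfolding R(2) by (rule emeasure_density) measurable
    also have "\<dots> \<le> (\<integral>\<^sup>+ z. ennreal (1 / (4 * T)) * (R z * R z) + ennreal T * indicator (A \<theta>) z \<partial>P j)"
    proof (rule nn_integral_mono)
      fix z
      show "R z * indicator (A \<theta>) z \<le> ennreal (1 / (4 * T)) * (R z * R z) + ennreal T * indicator (A \<theta>) z"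
        using pw[of z] by (auto simp: indicator_def)
    qed
    also have "\<dots> = ennreal (1 / (4 * T)) * (\<integral>\<^sup>+ z. R z * R z \<partial>P j) + ennreal T * emeasure (P j) (A \<theta>)"
      by (subst nn_integral_add) (auto simp: nn_integral_cmult)
    \<comment> \<open>The mean of R under \<open>P \<theta>\<close> is its second moment under
      \<open>P j\<close>, which is one plus the chi-square divergence.\<close>
    also have "(\<integral>\<^sup>+ z. R z * R z \<partial>P j) = (\<integral>\<^sup>+ z. R z \<partial>P \<theta>)"
      unfolding R(2) by (rule nn_integral_density[symmetric]) measurable
    also have "ennreal (1 / (4 * T)) * (\<integral>\<^sup>+ z. R z \<partial>P \<theta>) \<le> ennreal (1 / (4 * T)) * ennreal T"
      by (intro mult_left_mono R) simp
    also have "\<dots> = ennreal (1 / 4)" using T by (simp add: ennreal_mult''[symmetric])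
    \<comment> \<open>Summing over all of \<open>J\<close> removes the dependence on the particular
      j chosen for \<theta>, so the two sums can be exchanged below.\<close>
    also have "emeasure (P j) (A \<theta>) \<le> (\<Sum>j\<in>J. emeasure (P j) (A \<theta>))"
      using fin j by (intro member_le_sum) auto
    finally show ?thesis by (simp add: add_left_mono mult_left_mono)
  qed
  have 2: "(\<Sum>\<theta>\<in>N. emeasure (P j) (A \<theta>)) \<le> 1" if j: "j \<in> J" for j
  proof -
    interpret prob_space "P j" by (rule P(1)[OF j])
    have "(\<Sum>\<theta>\<in>N. emeasure (P j) (A \<theta>)) = emeasure (P j) (\<Union>\<theta>\<in>N. A \<theta>)"
      using fin A P(2)[OF j] by (intro sum_emeasure) auto
    then show ?thesis using measure_le_1 by simp
  qed
  have "(\<Sum>\<theta>\<in>N. emeasure (P \<theta>) (A \<theta>)) \<le>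
      (\<Sum>\<theta>\<in>N. ennreal (1 / 4) + ennreal T * (\<Sum>j\<in>J. emeasure (P j) (A \<theta>)))"
    by (intro sum_mono 1)
  also have "\<dots> = of_nat (card N) * ennreal (1 / 4) + ennreal T * (\<Sum>j\<in>J. \<Sum>\<theta>\<in>N. emeasure (P j) (A \<theta>))"
    by (subst sum.swap) (simp add: sum.distrib sum_distrib_left)
  also have "\<dots> \<le> of_nat (card N) * ennreal (1 / 4) + ennreal T * (\<Sum>j\<in>J. 1)"
    by (intro add_left_mono mult_left_mono sum_mono 2) auto
  also have "\<dots> = ennreal (real (card N) / 4 + T * real (card J))"
    using T by (simp add: ennreal_of_nat_eq_real_of_nat ennreal_mult''[symmetric] ennreal_mult[symmetric])
  finally show ?thesis .
qed

text \<open>Averaged over N, the term d P takes at most half of d, so the other half is left for s.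
  Here s will be the worst-case risk and P the probability that the estimate is close to the true
  function.\<close>

lemma sum_risk_lower:
  fixes P :: "'b \<Rightarrow> ennreal" and s :: ennreal and d :: real
  assumes N: "finite N" "N \<noteq> {}" and d: "0 \<le> d"
    and s: "\<And>\<theta>. \<theta> \<in> N \<Longrightarrow> ennreal d \<le> s + ennreal d * P \<theta>"
    and P: "(\<Sum>\<theta>\<in>N. P \<theta>) \<le> ennreal (real (card N) / 2)"
  shows "ennreal (d / 2) \<le> s"
proof (cases s)
  case (real r)
  define k where "k = real (card N)"
  have k: "0 < k" using N by (simp add: k_def card_gt_0_iff)
  have "of_nat (card N) * ennreal d = (\<Sum>\<theta>\<in>N. ennreal d)" by simp
  also have "\<dots> \<le> (\<Sum>\<theta>\<in>N. s + ennreal d * P \<theta>)" by (intro sum_mono s)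
  also have "\<dots> = of_nat (card N) * s + ennreal d * (\<Sum>\<theta>\<in>N. P \<theta>)"
    by (simp add: sum.distrib sum_distrib_left)
  also have "\<dots> \<le> of_nat (card N) * s + ennreal d * ennreal (real (card N) / 2)"
    by (intro add_left_mono mult_left_mono P) simp
  finally have "ennreal (k * d) \<le> ennreal (k * r + d * (k / 2))"
    using d real
    by (simp add: k_def ennreal_of_nat_eq_real_of_nat ennreal_mult'[symmetric] ennreal_plus[symmetric]
        del: ennreal_plus)
  then have "k * d \<le> k * r + d * (k / 2)"
    using d real k by (subst (asm) ennreal_le_iff) auto
  then have "k * (d / 2) \<le> k * r" by (simp add: algebra_simps)
  then have "d / 2 \<le> r" using k by simp
  then show ?thesis using real by (simp add: ennreal_leI)
qed simp

text \<open>With \<open>B\<close>, \<open>sbar\<close> and \<open>C\<close> as parameters, the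
  constants of both bounds are chosen before n, the packing and the net. The density ratio is in
  product form, which has a meaning also where \<open>h\<^sub>0\<close> vanishes.\<close>

locale expectile_model =
  fixes \<nu> :: "'a measure" and \<phi> :: real and \<U> \<S> \<H> :: "('a \<Rightarrow> real) set" and h\<^sub>0 :: "'a \<Rightarrow> real"
    and B sbar C :: real
  assumes phi: "0 < \<phi>" "\<phi> < 1"
    and dens: "h \<in> \<H> \<Longrightarrow> is_density \<nu> h"
    and meas_U: "\<mu> \<in> \<U> \<Longrightarrow> \<mu> \<in> borel_measurable \<nu>"
    and bounded_U: "\<mu> \<in> \<U> \<Longrightarrow> AE x in \<nu>. \<bar>\<mu> x\<bar> \<le> B" and B0: "0 \<le> B"
    and S_nonempty: "\<S> \<noteq> {}"
    and meas_S: "\<sigma> \<in> \<S> \<Longrightarrow> \<sigma> \<in> borel_measurable \<nu>"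
    and sbar: "1 < sbar"
    and bounds_S: "\<sigma> \<in> \<S> \<Longrightarrow> x \<in> space \<nu> \<Longrightarrow> 1 / sbar \<le> \<sigma> x \<and> \<sigma> x \<le> sbar"
    and h0: "h\<^sub>0 \<in> \<H>"
    and C0: "0 \<le> C"
    and ratio: "h \<in> \<H> \<Longrightarrow> x \<in> space \<nu> \<Longrightarrow> h x \<le> C * h\<^sub>0 x"
begin

abbreviation law :: "('a \<Rightarrow> real) \<Rightarrow> ('a \<Rightarrow> real) \<Rightarrow> ('a \<Rightarrow> real) \<Rightarrow> ('a \<times> real) measure" where
  "law \<mu> \<sigma> h \<equiv> regression_law \<nu> (asym_normal_density \<phi>) \<mu> \<sigma> h"

lemma bounded_diff_U:
  assumes "\<mu> \<in> \<U>" "u \<in> \<U>"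
  shows "AE x in \<nu>. \<bar>\<mu> x - u x\<bar> \<le> 2 * B"
  using bounded_U[OF assms(1)] bounded_U[OF assms(2)] by eventually_elim linarith

lemma sigma_pos: "\<sigma> \<in> \<S> \<Longrightarrow> x \<in> space \<nu> \<Longrightarrow> 0 < \<sigma> x"
  using bounds_S[of \<sigma> x] sbar zero_less_divide_1_iff[of sbar] by linarith

lemma prob_space_law:
  "\<mu> \<in> \<U> \<Longrightarrow> \<sigma> \<in> \<S> \<Longrightarrow> h \<in> \<H> \<Longrightarrow> prob_space (law \<mu> \<sigma> h)"
  by (intro prob_space_regression_law dens prob_space_asym_normal phi meas_U meas_S)

lemma L2_dist_sq_U:
  "h \<in> \<H> \<Longrightarrow> \<mu> \<in> \<U> \<Longrightarrow> u \<in> \<U> \<Longrightarrow> L2_dist_sq \<nu> h \<mu> u = ennreal ((L2_dist \<nu> h \<mu> u)\<^sup>2)"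
  by (intro L2_dist_sq_bounded[OF dens meas_U meas_U bounded_diff_U])

text \<open>Lets a net built once in the metric of \<open>h\<^sub>0\<close> control the loss under
  every covariate density.\<close>

lemma L2_dist_ratio:
  assumes h: "h \<in> \<H>" and \<mu>: "\<mu> \<in> \<U>" and u: "u \<in> \<U>"
  shows "(L2_dist \<nu> h \<mu> u)\<^sup>2 \<le> C * (L2_dist \<nu> h\<^sub>0 \<mu> u)\<^sup>2"
proof -
  note [measurable] = meas_U[OF \<mu>] meas_U[OF u] dens[OF h0]
  have "L2_dist_sq \<nu> h \<mu> u \<le> (\<integral>\<^sup>+ x. ennreal C * ennreal ((\<mu> x - u x)\<^sup>2 * h\<^sub>0 x) \<partial>\<nu>)"
    unfolding L2_dist_sq_def
  proof (rule nn_integral_mono)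
    fix x assume x: "x \<in> space \<nu>"
    have "(\<mu> x - u x)\<^sup>2 * h x \<le> (\<mu> x - u x)\<^sup>2 * (C * h\<^sub>0 x)"
      by (intro mult_left_mono ratio[OF h x]) simp
    also have "\<dots> = C * ((\<mu> x - u x)\<^sup>2 * h\<^sub>0 x)" by (simp add: mult.left_commute)
    finally show "ennreal ((\<mu> x - u x)\<^sup>2 * h x) \<le> ennreal C * ennreal ((\<mu> x - u x)\<^sup>2 * h\<^sub>0 x)"
      using C0 by (simp add: ennreal_mult'[symmetric] ennreal_leI)
  qed
  also have "\<dots> = ennreal C * L2_dist_sq \<nu> h\<^sub>0 \<mu> u"
    unfolding L2_dist_sq_def by (rule nn_integral_cmult) measurable
  finally have "ennreal ((L2_dist \<nu> h \<mu> u)\<^sup>2) \<le> ennreal (C * (L2_dist \<nu> h\<^sub>0 \<mu> u)\<^sup>2)"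
    using C0 by (simp add: L2_dist_sq_U h h0 \<mu> u ennreal_mult')
  then show ?thesis using C0 by (simp add: ennreal_le_iff)
qed

text \<open>The loss is rewritten as an integral against the covariate law. This is a probability
  measure, so joint measurability of the estimator passes to the integral even if
  \<open>\<nu>\<close> is not sigma-finite.\<close>

lemma measurable_loss:
  assumes est: "est \<in> estimators \<nu> n" and h: "h \<in> \<H>" and \<mu>: "\<mu> \<in> borel_measurable \<nu>"
  shows "(\<lambda>z. L2_dist_sq \<nu> h \<mu> (\<lambda>x. est (z, x))) \<in> borel_measurable (\<Pi>\<^sub>M i\<in>{..<n}. \<nu> \<Otimes>\<^sub>M borel)"
proof -
  let ?M = "\<Pi>\<^sub>M i\<in>{..<n}. \<nu> \<Otimes>\<^sub>M (borel :: real measure)" and ?X = "density \<nu> (\<lambda>x. ennreal (h x))"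
  interpret X: prob_space ?X by (rule prob_space_is_density[OF dens[OF h]])
  note [measurable] = \<mu>
  have [measurable]: "est \<in> borel_measurable (?M \<Otimes>\<^sub>M \<nu>)" using est by (simp add: estimators_def)
  have "(\<lambda>z. \<integral>\<^sup>+ x. ennreal ((\<mu> x - est (z, x))\<^sup>2) \<partial>?X) \<in> borel_measurable ?M"
    by measurable
  moreover have "L2_dist_sq \<nu> h \<mu> (\<lambda>x. est (z, x)) = (\<integral>\<^sup>+ x. ennreal ((\<mu> x - est (z, x))\<^sup>2) \<partial>?X)"
    if "z \<in> space ?M" for z
    using that by (intro L2_dist_sq_eq dens h \<mu>) measurable
  ultimately show ?thesis by (simp cong: measurable_cong)
qed

text \<open>The log ratio is a sum of loss differences between standardized residuals e + t and e,
  where t = (mu x - u x) / sigma x. The mean of the ratio under the first law is thus an exponential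
  moment with exponent 1. Dividing by sigma x >= 1 / sbar costs sbar in the range of t and sbar^2 in
  the final exponent.\<close>

lemma likelihood_ratio:
  assumes K: "\<And>d. \<bar>d\<bar> \<le> 2 * B * sbar \<Longrightarrow>
      (\<integral>\<^sup>+ e. ennreal (exp (asym_sq \<phi> (e + d) - asym_sq \<phi> e)) \<partial>asym_normal \<phi>) \<le> ennreal (1 + K * d\<^sup>2)"
    and K0: "0 \<le> K"
    and \<mu>: "\<mu> \<in> \<U>" and u: "u \<in> \<U>" and \<sigma>: "\<sigma> \<in> \<S>" and h: "h \<in> \<H>"
  shows "\<exists>R\<in>borel_measurable (\<Pi>\<^sub>M i\<in>{..<n}. \<nu> \<Otimes>\<^sub>M borel).
    (\<Pi>\<^sub>M i\<in>{..<n}. law \<mu> \<sigma> h) = density (\<Pi>\<^sub>M i\<in>{..<n}. law u \<sigma> h) R \<and>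
    (\<integral>\<^sup>+ z. R z \<partial>(\<Pi>\<^sub>M i\<in>{..<n}. law \<mu> \<sigma> h)) \<le> ennreal (exp (real n * (K * sbar\<^sup>2 * (L2_dist \<nu> h \<mu> u)\<^sup>2)))"
proof -
  note [measurable] = meas_U[OF \<mu>] meas_U[OF u] meas_S[OF \<sigma>]
  note E = prob_space_asym_normal[OF phi]
  define q where "q z = asym_sq \<phi> ((snd z - u (fst z)) / \<sigma> (fst z)) - asym_sq \<phi> ((snd z - \<mu> (fst z)) / \<sigma> (fst z))" for z
  have [measurable]: "q \<in> borel_measurable (\<nu> \<Otimes>\<^sub>M borel)" unfolding q_def[abs_def] by measurable
  have ratio: "asym_normal_density \<phi> ((snd z - \<mu> (fst z)) / \<sigma> (fst z)) /
      asym_normal_density \<phi> ((snd z - u (fst z)) / \<sigma> (fst z)) = exp (q z)" for z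
    using asym_normal_const_pos[OF phi] by (simp add: asym_normal_density_eq q_def exp_diff exp_minus field_simps)
  have dens1: "law \<mu> \<sigma> h = density (law u \<sigma> h) (\<lambda>z. ennreal (exp (q z)))"
    using regression_law_density[OF asym_normal_density_pos[OF phi] _ E, of \<mu> \<nu> u \<sigma> h] sigma_pos[OF \<sigma>]
    by (simp add: ratio)
  have P: "prob_space (density (law u \<sigma> h) (\<lambda>z. ennreal (exp (q z))))"
    using prob_space_law[OF \<mu> \<sigma> h] by (simp add: dens1)
  have prod: "(\<Prod>i<n. ennreal (exp (q (z i)))) = ennreal (exp (\<Sum>i<n. q (z i)))" for z :: "nat \<Rightarrow> 'a \<times> real"
    by (simp add: exp_sum prod_ennreal)
  have 1: "(\<Pi>\<^sub>M i\<in>{..<n}. law \<mu> \<sigma> h) =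
      density (\<Pi>\<^sub>M i\<in>{..<n}. law u \<sigma> h) (\<lambda>z. ennreal (exp (\<Sum>i<n. q (z i))))"
    unfolding dens1 using PiM_density[OF prob_space_law[OF u \<sigma> h] P, of "{..<n}"] by (simp add: prod)
  have 2: "(\<integral>\<^sup>+ z. ennreal (exp (\<Sum>i<n. q (z i))) \<partial>(\<Pi>\<^sub>M i\<in>{..<n}. law \<mu> \<sigma> h))
      \<le> ennreal (exp (real n * (K * sbar\<^sup>2 * (L2_dist \<nu> h \<mu> u)\<^sup>2)))"
  proof (rule regression_law_exp_moment[OF dens[OF h] E])
    show "AE x in \<nu>. \<bar>\<mu> x - u x\<bar> \<le> 2 * B" by (rule bounded_diff_U[OF \<mu> u])
    show "0 \<le> 1 + K * sbar\<^sup>2 * (2 * B)\<^sup>2" using K0 by simp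
    fix x assume x: "x \<in> space \<nu>" and d: "\<bar>\<mu> x - u x\<bar> \<le> 2 * B"
    define t where "t = (\<mu> x - u x) / \<sigma> x"
    have s: "0 < \<sigma> x" "1 / sbar \<le> \<sigma> x" using sigma_pos[OF \<sigma> x] bounds_S[OF \<sigma> x] by auto
    have "1 / \<sigma> x \<le> sbar" using s sbar by (simp add: field_simps)
    then have t: "\<bar>t\<bar> \<le> \<bar>\<mu> x - u x\<bar> * sbar"
      using s mult_left_mono[of "1 / \<sigma> x" sbar "\<bar>\<mu> x - u x\<bar>"] by (simp add: t_def)
    also have "\<dots> \<le> 2 * B * sbar" using d sbar by (intro mult_right_mono) auto
    finally have tB: "\<bar>t\<bar> \<le> 2 * B * sbar" .
    have "q (x, \<mu> x + \<sigma> x * e) = asym_sq \<phi> (e + t) - asym_sq \<phi> e" for e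
    proof -
      have "(\<mu> x + \<sigma> x * e - u x) / \<sigma> x = e + t" "(\<mu> x + \<sigma> x * e - \<mu> x) / \<sigma> x = e"
        using s by (auto simp: t_def field_simps)
      then show ?thesis by (simp add: q_def)
    qed
    then have "(\<integral>\<^sup>+ e. ennreal (exp (q (x, \<mu> x + \<sigma> x * e))) \<partial>asym_normal \<phi>) \<le> ennreal (1 + K * t\<^sup>2)"
      using K[OF tB] by simp
    also have "\<dots> \<le> ennreal (1 + K * sbar\<^sup>2 * (\<mu> x - u x)\<^sup>2)"
    proof -
      have "t\<^sup>2 \<le> (\<bar>\<mu> x - u x\<bar> * sbar)\<^sup>2" using power_mono[OF t, of 2] by simp
      then have "K * t\<^sup>2 \<le> K * (\<bar>\<mu> x - u x\<bar> * sbar)\<^sup>2" by (rule mult_left_mono[OF _ K0])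
      then show ?thesis by (intro ennreal_leI) (simp add: power_mult_distrib mult_ac)
    qed
    finally show "(\<integral>\<^sup>+ e. ennreal (exp (q (x, \<mu> x + \<sigma> x * e))) \<partial>asym_normal \<phi>)
        \<le> ennreal (1 + K * sbar\<^sup>2 * (\<mu> x - u x)\<^sup>2)" .
  qed measurable
  have "(\<lambda>z. ennreal (exp (\<Sum>i<n. q (z i)))) \<in> borel_measurable (\<Pi>\<^sub>M i\<in>{..<n}. \<nu> \<Otimes>\<^sub>M borel)"
    by measurable
  with 1 2 show ?thesis by blast
qed

text \<open>The 4 in the cardinality condition brings the testing bound card N / 4 + T card J down
  to card N / 2; delta^2 / 8 is half of the closeness level delta^2 / 4.\<close>

theorem minimax_risk_lower_bound:
  obtains \<kappa> where "0 \<le> \<kappa>"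
    and "\<And>n N J \<delta> e. packing_set \<nu> h\<^sub>0 \<U> \<delta> N \<Longrightarrow> N \<noteq> {} \<Longrightarrow> finite J \<Longrightarrow> J \<subseteq> \<U> \<Longrightarrow> 0 < \<delta> \<Longrightarrow> 
      (\<And>\<mu>. \<mu> \<in> N \<Longrightarrow> \<exists>u\<in>J. L2_dist \<nu> h\<^sub>0 \<mu> u \<le> e) \<Longrightarrow>
      4 * exp (real n * \<kappa> * e\<^sup>2) * real (card J) \<le> real (card N) \<Longrightarrow>
      ennreal (\<delta>\<^sup>2 / 8) \<le> minimax_risk \<nu> (asym_normal_density \<phi>) \<U> \<S> \<H> n"
proof -
  have "0 \<le> 2 * B * sbar" using B0 sbar by simp
  from asym_sq_exp_moment[OF phi this zero_le_one] obtain K where K: "0 \<le> K"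
    "\<And>t d s. \<bar>t\<bar> \<le> 1 \<Longrightarrow> \<bar>d\<bar> \<le> 2 * B * sbar \<Longrightarrow> 0 < s \<Longrightarrow> s \<le> 1 \<Longrightarrow>
      (\<integral>\<^sup>+ e. ennreal (exp (t * (asym_sq \<phi> (s * e + d) - asym_sq \<phi> (s * e)))) \<partial>asym_normal \<phi>)
        \<le> ennreal (1 + (max t (min \<phi> (1 - \<phi>) * t) + t\<^sup>2 * K) * d\<^sup>2)" by blast
  \<comment> \<open>Scale 1 suffices: the residuals are standardized and the scale has moved into
    the shift, whence its range 2 B sbar.\<close>
  have K1: "(\<integral>\<^sup>+ e. ennreal (exp (asym_sq \<phi> (e + d) - asym_sq \<phi> e)) \<partial>asym_normal \<phi>)
      \<le> ennreal (1 + (1 + K) * d\<^sup>2)" if "\<bar>d\<bar> \<le> 2 * B * sbar" for d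
    using K(2)[of 1 d 1] that phi by (simp add: max_def)
  have K10: "0 \<le> 1 + K" using K by simp
  define \<kappa> where "\<kappa> = (1 + K) * sbar\<^sup>2"
  have \<kappa>0: "0 \<le> \<kappa>" using K by (simp add: \<kappa>_def)
  show thesis
  proof (rule that[OF \<kappa>0])
    fix n :: nat and N J :: "('a \<Rightarrow> real) set" and \<delta> e :: real
    assume N: "packing_set \<nu> h\<^sub>0 \<U> \<delta> N" "N \<noteq> {}" and J: "finite J" "J \<subseteq> \<U>" and \<delta>: "0 < \<delta>"
      and cover: "\<And>\<mu>. \<mu> \<in> N \<Longrightarrow> \<exists>u\<in>J. L2_dist \<nu> h\<^sub>0 \<mu> u \<le> e"
      and card: "4 * exp (real n * \<kappa> * e\<^sup>2) * real (card J) \<le> real (card N)"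
    from N have fin: "finite N" and NU: "N \<subseteq> \<U>"
      and sep: "\<And>g g'. g \<in> N \<Longrightarrow> g' \<in> N \<Longrightarrow> g \<noteq> g' \<Longrightarrow> \<delta> < L2_dist \<nu> h\<^sub>0 g g'"
      by (auto simp: packing_set_def)
    \<comment> \<open>A subfamily bounds the supremum from below, so one scale and the density
      \<open>h\<^sub>0\<close> are kept fixed.\<close>
    obtain \<sigma> where \<sigma>: "\<sigma> \<in> \<S>" using S_nonempty by auto
    let ?M = "\<Pi>\<^sub>M i\<in>{..<n}. \<nu> \<Otimes>\<^sub>M (borel :: real measure)"
    define P where "P \<mu> = (\<Pi>\<^sub>M i\<in>{..<n}. law \<mu> \<sigma> h\<^sub>0)" for \<mu>
    have sets_P: "sets (P \<mu>) = sets ?M" for \<mu> unfolding P_def by (intro sets_PiM_cong) auto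
    have prob_P: "prob_space (P \<mu>)" if "\<mu> \<in> \<U>" for \<mu>
      unfolding P_def by (intro prob_space_PiM prob_space_law that \<sigma> h0)
    show "ennreal (\<delta>\<^sup>2 / 8) \<le> minimax_risk \<nu> (asym_normal_density \<phi>) \<U> \<S> \<H> n"
      unfolding minimax_risk_def
    proof (rule INF_greatest)
      fix est assume est: "est \<in> estimators \<nu> n"
      let ?l = "\<lambda>\<mu> z. L2_dist_sq \<nu> h\<^sub>0 \<mu> (\<lambda>x. est (z, x))"
      let ?s = "SUP (\<mu>, \<sigma>, h)\<in>\<U> \<times> \<S> \<times> \<H>. risk \<nu> (asym_normal_density \<phi>) n est \<mu> \<sigma> h"
      define d where "d = \<delta>\<^sup>2 / 4"
      have d: "0 \<le> d" by (simp add: d_def)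
      \<comment> \<open>Data on which the estimate is close to mu. Two such sets are disjoint:
        otherwise the two functions would have squared distance at most 2 (d + d) = delta^2, against
        their separation.\<close>
      define A where "A \<mu> = {z \<in> space ?M. ?l \<mu> z < ennreal d}" for \<mu>
      have l_meas: "?l \<mu> \<in> borel_measurable ?M" if "\<mu> \<in> \<U>" for \<mu>
        by (rule measurable_loss[OF est h0 meas_U[OF that]])
      have A: "A \<mu> \<in> sets ?M" if "\<mu> \<in> \<U>" for \<mu>
        unfolding A_def using l_meas[OF that] by measurable
      have disj: "disjoint_family_on A N"
        unfolding disjoint_family_on_def
      proof (intro ballI impI, rule ccontr)
        fix g g' assume g: "g \<in> N" "g' \<in> N" "g \<noteq> g'" and "A g \<inter> A g' \<noteq> {}"
        then obtain z where z: "z \<in> space ?M" "?l g z < ennreal d" "?l g' z < ennreal d"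
          by (auto simp: A_def)
        have "est \<in> borel_measurable (?M \<Otimes>\<^sub>M \<nu>)" using est by (simp add: estimators_def)
        then have m: "(\<lambda>x. est (z, x)) \<in> borel_measurable \<nu>"
          using z(1) by measurable
        have gU: "g \<in> \<U>" "g' \<in> \<U>" using g NU by auto
        have "L2_dist_sq \<nu> h\<^sub>0 g g' \<le> 2 * (?l g z + L2_dist_sq \<nu> h\<^sub>0 (\<lambda>x. est (z, x)) g')"
          by (rule L2_dist_sq_triangle[OF dens[OF h0] meas_U[OF gU(1)] m meas_U[OF gU(2)]])
        also have "\<dots> \<le> 2 * (ennreal d + ennreal d)"
          using z by (intro mult_left_mono add_mono) (auto simp: L2_dist_sq_commute[of _ _ _ g'])
        also have "\<dots> = ennreal (\<delta>\<^sup>2)"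
          using d by (simp add: ennreal_plus[symmetric] ennreal_mult'[symmetric] ennreal_numeral[symmetric]
              d_def del: ennreal_plus ennreal_numeral)
        finally have "(L2_dist \<nu> h\<^sub>0 g g')\<^sup>2 \<le> \<delta>\<^sup>2"
          by (simp add: L2_dist_sq_U[OF h0 gU] ennreal_le_iff)
        then have "L2_dist \<nu> h\<^sub>0 g g' \<le> \<delta>" using \<delta> by (simp add: power2_le_iff_abs_le)
        then show False using sep[OF g] by simp
      qed
      have "(\<Sum>\<mu>\<in>N. emeasure (P \<mu>) (A \<mu>)) \<le> ennreal (real (card N) / 4 + exp (real n * \<kappa> * e\<^sup>2) * real (card J))"
      proof (rule multiple_testing_bound[OF fin J(1), where M="?M"])
        fix \<mu> assume \<mu>: "\<mu> \<in> N"
        obtain u where u: "u \<in> J" "L2_dist \<nu> h\<^sub>0 \<mu> u \<le> e" using cover[OF \<mu>] by auto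
        have \<mu>U: "\<mu> \<in> \<U>" and uU: "u \<in> \<U>" using \<mu> u NU J by auto
        obtain R where R: "R \<in> borel_measurable ?M" "P \<mu> = density (P u) R"
          "(\<integral>\<^sup>+ z. R z \<partial>P \<mu>) \<le> ennreal (exp (real n * (\<kappa> * (L2_dist \<nu> h\<^sub>0 \<mu> u)\<^sup>2)))"
          using likelihood_ratio[OF K1 K10 \<mu>U uU \<sigma> h0, of n] unfolding P_def \<kappa>_def by auto
        have "(L2_dist \<nu> h\<^sub>0 \<mu> u)\<^sup>2 \<le> e\<^sup>2"
          using u by (intro power_mono) (auto simp: L2_dist_def)
        then have "real n * (\<kappa> * (L2_dist \<nu> h\<^sub>0 \<mu> u)\<^sup>2) \<le> real n * (\<kappa> * e\<^sup>2)"
          using \<kappa>0 by (intro mult_left_mono) auto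
        then have "ennreal (exp (real n * (\<kappa> * (L2_dist \<nu> h\<^sub>0 \<mu> u)\<^sup>2))) \<le> ennreal (exp (real n * \<kappa> * e\<^sup>2))"
          by (intro ennreal_leI) (simp add: mult.assoc)
        with R(3) have "(\<integral>\<^sup>+ z. R z \<partial>P \<mu>) \<le> ennreal (exp (real n * \<kappa> * e\<^sup>2))" by (rule order.trans)
        with R u show "\<exists>j\<in>J. \<exists>R\<in>borel_measurable ?M.
            P \<mu> = density (P j) R \<and> (\<integral>\<^sup>+ z. R z \<partial>P \<mu>) \<le> ennreal (exp (real n * \<kappa> * e\<^sup>2))" by blast
      qed (use A disj NU J in \<open>auto intro: prob_P simp: sets_P\<close>)
      also have "\<dots> \<le> ennreal (real (card N) / 2)" using card by (intro ennreal_leI) simp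
      finally have sum: "(\<Sum>\<mu>\<in>N. emeasure (P \<mu>) (A \<mu>)) \<le> ennreal (real (card N) / 2)" .
      have "ennreal d \<le> ?s + ennreal d * emeasure (P \<mu>) (A \<mu>)" if \<mu>: "\<mu> \<in> N" for \<mu>
      proof -
        have \<mu>U: "\<mu> \<in> \<U>" using \<mu> NU by auto
        interpret P: prob_space "P \<mu>" by (rule prob_P[OF \<mu>U])
        have lm[measurable]: "?l \<mu> \<in> borel_measurable (P \<mu>)"
          using l_meas[OF \<mu>U] by (simp add: measurable_cong_sets[OF sets_P refl])
        have Am[measurable]: "A \<mu> \<in> sets (P \<mu>)" using A[OF \<mu>U] by (simp add: sets_P)
        have "ennreal d = (\<integral>\<^sup>+ z. ennreal d \<partial>P \<mu>)" by (simp add: P.emeasure_space_1)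
        also have "\<dots> \<le> (\<integral>\<^sup>+ z. ?l \<mu> z + ennreal d * indicator (A \<mu>) z \<partial>P \<mu>)"
        proof (rule nn_integral_mono)
          fix z assume "z \<in> space (P \<mu>)"
          then have "z \<in> space ?M" using sets_eq_imp_space_eq[OF sets_P] by auto
          then show "ennreal d \<le> ?l \<mu> z + ennreal d * indicator (A \<mu>) z"
            by (auto simp: A_def indicator_def not_less)
        qed
        also have "\<dots> = (\<integral>\<^sup>+ z. ?l \<mu> z \<partial>P \<mu>) + ennreal d * emeasure (P \<mu>) (A \<mu>)"
          by (subst nn_integral_add) (auto simp: nn_integral_cmult)
        also have "(\<integral>\<^sup>+ z. ?l \<mu> z \<partial>P \<mu>) = risk \<nu> (asym_normal_density \<phi>) n est \<mu> \<sigma> h\<^sub>0"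
          by (simp add: risk_def P_def)
        also have "\<dots> \<le> ?s" using \<mu>U \<sigma> h0 by (intro SUP_upper2[of "(\<mu>, \<sigma>, h\<^sub>0)"]) auto
        finally show ?thesis by (simp add: add_right_mono)
      qed
      from sum_risk_lower[OF fin N(2) d this sum] show "ennreal (\<delta>\<^sup>2 / 8) \<le> ?s" by (simp add: d_def)
    qed
  qed
qed

end

section \<open>Upper bound\<close>

text \<open>Turns an exponential moment into a bound on a mean: with a the logarithm of the moment,
  the mean exceeds a by at most 1.\<close>

lemma le_add_exp_diff: "(x::real) \<le> a + exp (x - a)"
  using exp_ge_add_one_self[of "x - a"] by linarith

section \<open>Empirical risk minimization over a finite net\<close>

context expectile_model
begin

text \<open>Residuals are not divided by the unknown scale, and the part belonging to mu does not
  depend on u, so minimizing over u requires the data only.\<close>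

definition excess_loss :: "nat \<Rightarrow> ('a \<Rightarrow> real) \<Rightarrow> ('a \<Rightarrow> real) \<Rightarrow> (nat \<Rightarrow> 'a \<times> real) \<Rightarrow> real" where
  "excess_loss n \<mu> u z =
     (\<Sum>i<n. asym_sq \<phi> (snd (z i) - u (fst (z i))) - asym_sq \<phi> (snd (z i) - \<mu> (fst (z i))))"

lemma measurable_excess_loss [measurable]:
  assumes [measurable]: "\<mu> \<in> borel_measurable \<nu>" "u \<in> borel_measurable \<nu>"
  shows "excess_loss n \<mu> u \<in> borel_measurable (\<Pi>\<^sub>M i\<in>{..<n}. \<nu> \<Otimes>\<^sub>M borel)"
  unfolding excess_loss_def[abs_def] by measurable

text \<open>Serves with t = 1 and positive r as well as with negative t and r. The scale stays
  inside the loss, so the moment bound is assumed for all s up to \<open>sbar\<close>.\<close>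

lemma excess_loss_exp_moment:
  assumes K: "\<And>d s. \<bar>d\<bar> \<le> 2 * B \<Longrightarrow> 0 < s \<Longrightarrow> s \<le> sbar \<Longrightarrow>
      (\<integral>\<^sup>+ e. ennreal (exp (t * (asym_sq \<phi> (s * e + d) - asym_sq \<phi> (s * e)))) \<partial>asym_normal \<phi>)
        \<le> ennreal (1 + r * d\<^sup>2)"
    and r: "0 \<le> 1 + r * (2 * B)\<^sup>2"
    and \<mu>: "\<mu> \<in> \<U>" and u: "u \<in> \<U>" and \<sigma>: "\<sigma> \<in> \<S>" and h: "h \<in> \<H>"
  shows "(\<integral>\<^sup>+ z. ennreal (exp (t * excess_loss n \<mu> u z)) \<partial>(\<Pi>\<^sub>M i\<in>{..<n}. law \<mu> \<sigma> h))
    \<le> ennreal (exp (real n * (r * (L2_dist \<nu> h \<mu> u)\<^sup>2)))"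
proof -
  note [measurable] = meas_U[OF \<mu>] meas_U[OF u] meas_S[OF \<sigma>]
  define q where "q z = t * (asym_sq \<phi> (snd z - u (fst z)) - asym_sq \<phi> (snd z - \<mu> (fst z)))" for z
  have [measurable]: "q \<in> borel_measurable (\<nu> \<Otimes>\<^sub>M borel)" unfolding q_def[abs_def] by measurable
  have "(\<integral>\<^sup>+ z. ennreal (exp (\<Sum>i<n. q (z i))) \<partial>(\<Pi>\<^sub>M i\<in>{..<n}. law \<mu> \<sigma> h))
      \<le> ennreal (exp (real n * (r * (L2_dist \<nu> h \<mu> u)\<^sup>2)))"
  proof (rule regression_law_exp_moment[OF dens[OF h] prob_space_asym_normal[OF phi]])
    show "AE x in \<nu>. \<bar>\<mu> x - u x\<bar> \<le> 2 * B" by (rule bounded_diff_U[OF \<mu> u])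
    show "0 \<le> 1 + r * (2 * B)\<^sup>2" by (rule r)
    fix x assume x: "x \<in> space \<nu>" and d: "\<bar>\<mu> x - u x\<bar> \<le> 2 * B"
    have "q (x, \<mu> x + \<sigma> x * e) = t * (asym_sq \<phi> (\<sigma> x * e + (\<mu> x - u x)) - asym_sq \<phi> (\<sigma> x * e))" for e
      by (simp add: q_def algebra_simps)
    then show "(\<integral>\<^sup>+ e. ennreal (exp (q (x, \<mu> x + \<sigma> x * e))) \<partial>asym_normal \<phi>)
        \<le> ennreal (1 + r * (\<mu> x - u x)\<^sup>2)"
      using K[OF d sigma_pos[OF \<sigma> x]] bounds_S[OF \<sigma> x] by simp
  qed measurable
  then show ?thesis by (simp add: q_def excess_loss_def sum_distrib_left)
qed

text \<open>Measurable selection: take the minimizer of least index in an enumeration of N. The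
  index is a measurable function of the data with countably many values. One w serves every mu
  because the loss at mu cancels from the comparison.\<close>

lemma empirical_risk_minimizer:
  assumes N: "finite N" "N \<noteq> {}" "N \<subseteq> \<U>"
  obtains w where "\<And>z. w z \<in> N" "\<And>\<mu> u z. u \<in> N \<Longrightarrow> excess_loss n \<mu> (w z) z \<le> excess_loss n \<mu> u z"
    and "(\<lambda>(z, x). w z x) \<in> estimators \<nu> n"
proof -
  let ?M = "\<Pi>\<^sub>M i\<in>{..<n}. \<nu> \<Otimes>\<^sub>M (borel :: real measure)"
  define v where "v = from_nat_into N"
  have range: "range v = N"
    unfolding v_def using N by (intro range_from_nat_into) (auto intro: countable_finite)
  define L where "L u z = (\<Sum>i<n. asym_sq \<phi> (snd (z i) - u (fst (z i))))" for u :: "'a \<Rightarrow> real" and z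
  have v_meas[measurable]: "v k \<in> borel_measurable \<nu>" for k using range N meas_U by auto
  have L_meas: "L u \<in> borel_measurable ?M" if "u \<in> N" for u
  proof -
    have [measurable]: "u \<in> borel_measurable \<nu>" using that N meas_U by auto
    show ?thesis unfolding L_def[abs_def] by measurable
  qed
  have Lv: "L (v k) \<in> borel_measurable ?M" for k using L_meas range by auto
  define P where "P k z \<longleftrightarrow> (\<forall>u\<in>N. L (v k) z \<le> L u z)" for k z
  have [measurable]: "Measurable.pred ?M (P k)" for k
    unfolding P_def[abs_def]
  proof (intro pred_intros_finite N)
    fix u assume "u \<in> N"
    then show "Measurable.pred ?M (\<lambda>z. L (v k) z \<le> L u z)"
      unfolding pred_def by (intro borel_measurable_le Lv L_meas)
  qed
  define k where "k z = (LEAST k. P k z)" for z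
  have k_meas[measurable]: "k \<in> ?M \<rightarrow>\<^sub>M count_space UNIV"
    unfolding k_def[abs_def] by measurable
  have P_k: "P (k z) z" for z
  proof -
    obtain u where "u \<in> N" "\<forall>u'\<in>N. L u z \<le> L u' z"
      using arg_min_if_finite(1)[OF N(1,2)] arg_min_least[OF N(1,2), of _ "\<lambda>u. L u z"] that by blast
    then have "\<exists>k. P k z" unfolding P_def using range by (metis rangeE)
    then show ?thesis unfolding k_def by (rule LeastI_ex)
  qed
  show thesis
  proof (rule that[of "\<lambda>z. v (k z)"])
    show "v (k z) \<in> N" for z using range by auto
    show "excess_loss n \<mu> (v (k z)) z \<le> excess_loss n \<mu> u z" if "u \<in> N" for \<mu> u z
      using P_k[of z] that by (simp add: P_def L_def excess_loss_def sum_subtractf)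
    have "(\<lambda>y. v (k (fst y)) (snd y)) \<in> borel_measurable (?M \<Otimes>\<^sub>M \<nu>)"
      by (rule measurable_compose_countable[of "\<lambda>i y. v i (snd y)"]) measurable
    then show "(\<lambda>(z, x). v (k z) x) \<in> estimators \<nu> n"
      by (simp add: estimators_def split_beta')
  qed
qed

text \<open>
  Both \<open>n c d(w z) - \<tau>\<close> times the excess loss of the minimizer and the excess loss of \<open>v\<close> are bounded
  through \<open>x \<le> a + exp (x - a)\<close>. The first exponential is at most the sum of those of all \<open>u\<close> in \<open>N\<close>,
  each of mean at most \<open>1\<close>, so \<open>a = ln (card N)\<close> suffices.
\<close>

lemma minimizer_risk:
  assumes K1: "0 \<le> K1" and \<tau>: "0 < \<tau>" "\<tau> \<le> 1" and c: "0 < c" and n: "0 < n"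
    and pos: "\<And>u. u \<in> N \<Longrightarrow> (\<integral>\<^sup>+ z. ennreal (exp (excess_loss n \<mu> u z)) \<partial>(\<Pi>\<^sub>M i\<in>{..<n}. law \<mu> \<sigma> h))
        \<le> ennreal (exp (real n * (K1 * (L2_dist \<nu> h \<mu> u)\<^sup>2)))"
    and neg: "\<And>u. u \<in> N \<Longrightarrow> (\<integral>\<^sup>+ z. ennreal (exp (- \<tau> * excess_loss n \<mu> u z)) \<partial>(\<Pi>\<^sub>M i\<in>{..<n}. law \<mu> \<sigma> h))
        \<le> ennreal (exp (real n * (- c * (L2_dist \<nu> h \<mu> u)\<^sup>2)))"
    and N: "finite N" "N \<subseteq> \<U>" and v: "v \<in> N" and \<mu>: "\<mu> \<in> \<U>" and \<sigma>: "\<sigma> \<in> \<S>" and h: "h \<in> \<H>"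
    and w: "\<And>z. w z \<in> N" "\<And>z. excess_loss n \<mu> (w z) z \<le> excess_loss n \<mu> v z"
  shows "risk \<nu> (asym_normal_density \<phi>) n (\<lambda>(z, x). w z x) \<mu> \<sigma> h
    \<le> ennreal ((K1 * (L2_dist \<nu> h \<mu> v)\<^sup>2 + (2 + ln (real (card N))) / real n) / c)"
proof -
  let ?P = "\<Pi>\<^sub>M i\<in>{..<n}. law \<mu> \<sigma> h"
  define d where "d u = (L2_dist \<nu> h \<mu> u)\<^sup>2" for u
  define l where "l = ln (real (card N))"
  \<comment> \<open>Logarithm of the moment bound at v, so that \<open>?E\<close> below has mean at
    most 1.\<close>
  define T where "T = real n * (K1 * d v)"
  define b where "b = 1 / (real n * c)"
  have L: "0 < card N" using N v by (auto simp: card_gt_0_iff)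
  have l0: "0 \<le> l" "exp (- l) = 1 / real (card N)" using L by (auto simp: l_def exp_minus field_simps)
  have T0: "0 \<le> T" using K1 by (simp add: T_def d_def)
  have b0: "0 < b" using n c by (simp add: b_def)
  interpret P: prob_space ?P by (intro prob_space_PiM prob_space_law \<mu> \<sigma> h)
  have sets_P: "sets ?P = sets (\<Pi>\<^sub>M i\<in>{..<n}. \<nu> \<Otimes>\<^sub>M borel)" by (intro sets_PiM_cong) auto
  have meas: "excess_loss n \<mu> u \<in> borel_measurable ?P" if "u \<in> N" for u
    using measurable_excess_loss[OF meas_U[OF \<mu>] meas_U, of u n] that N
    by (auto simp: measurable_cong_sets[OF sets_P refl])
  let ?E = "\<lambda>z. exp (- T) * exp (excess_loss n \<mu> v z)"
  let ?F = "\<lambda>u z. exp (- l) * (exp (real n * (c * d u)) * exp (- \<tau> * excess_loss n \<mu> u z))"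
  have pw: "d (w z) \<le> b * ((T + l) + (?E z + (\<Sum>u\<in>N. ?F u z)))" for z
  proof -
    let ?W = "real n * (c * d (w z)) - \<tau> * excess_loss n \<mu> (w z) z"
    have "?W \<le> l + exp (?W - l)" by (rule le_add_exp_diff)
    also have "exp (?W - l) = ?F (w z) z" by (simp add: exp_diff exp_add exp_minus field_simps)
    \<comment> \<open>The minimizer depends on the data, so the sum over the whole net stands in for
      whichever element is selected.\<close>
    also have "\<dots> \<le> (\<Sum>u\<in>N. ?F u z)"
      using w(1) N(1) by (intro member_le_sum[of "w z" N "\<lambda>u. ?F u z"]) auto
    finally have 1: "?W \<le> l + (\<Sum>u\<in>N. ?F u z)" by simp
    have "excess_loss n \<mu> (w z) z \<le> T + exp (excess_loss n \<mu> v z - T)"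
      using w(2)[of z] le_add_exp_diff[of "excess_loss n \<mu> v z" T] by linarith
    then have "\<tau> * excess_loss n \<mu> (w z) z \<le> \<tau> * (T + exp (excess_loss n \<mu> v z - T))"
      using \<tau> by (intro mult_left_mono) auto
    also have "\<dots> \<le> 1 * (T + exp (excess_loss n \<mu> v z - T))"
      using \<tau> T0 by (intro mult_right_mono) auto
    also have "\<dots> = T + ?E z" by (simp add: exp_diff exp_minus field_simps)
    finally have "real n * (c * d (w z)) \<le> (T + l) + (?E z + (\<Sum>u\<in>N. ?F u z))" using 1 by linarith
    then have "b * (real n * (c * d (w z))) \<le> b * ((T + l) + (?E z + (\<Sum>u\<in>N. ?F u z)))"
      using b0 by (intro mult_left_mono) auto
    then show ?thesis using n c by (simp add: b_def)
  qed
  have F: "(\<integral>\<^sup>+ z. ennreal (?F u z) \<partial>?P) \<le> ennreal (exp (- l))" if u: "u \<in> N" for u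
  proof -
    note [measurable] = meas[OF u]
    have "(\<integral>\<^sup>+ z. ennreal (?F u z) \<partial>?P) = (\<integral>\<^sup>+ z. ennreal (exp (- l) * exp (real n * (c * d u))) *
        ennreal (exp (- \<tau> * excess_loss n \<mu> u z)) \<partial>?P)"
      by (simp add: ennreal_mult'[symmetric] mult.assoc)
    also have "\<dots> = ennreal (exp (- l) * exp (real n * (c * d u))) *
        (\<integral>\<^sup>+ z. ennreal (exp (- \<tau> * excess_loss n \<mu> u z)) \<partial>?P)"
      by (rule nn_integral_cmult) measurable
    also have "\<dots> \<le> ennreal (exp (- l) * exp (real n * (c * d u))) * ennreal (exp (real n * (- c * d u)))"
      using neg[OF u] by (intro mult_left_mono) (auto simp: d_def)
    also have "\<dots> = ennreal (exp (- l))"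
      by (simp add: ennreal_mult'[symmetric] flip: exp_add)
    finally show ?thesis .
  qed
  have E: "(\<integral>\<^sup>+ z. ennreal (?E z) \<partial>?P) \<le> 1"
  proof -
    note [measurable] = meas[OF v]
    have "(\<integral>\<^sup>+ z. ennreal (?E z) \<partial>?P) = (\<integral>\<^sup>+ z. ennreal (exp (- T)) * ennreal (exp (excess_loss n \<mu> v z)) \<partial>?P)"
      by (simp add: ennreal_mult'[symmetric])
    also have "\<dots> = ennreal (exp (- T)) * (\<integral>\<^sup>+ z. ennreal (exp (excess_loss n \<mu> v z)) \<partial>?P)"
      by (rule nn_integral_cmult) measurable
    also have "\<dots> \<le> ennreal (exp (- T)) * ennreal (exp T)"
      using pos[OF v] by (intro mult_left_mono) (auto simp: d_def T_def)
    also have "\<dots> = 1" by (simp add: ennreal_mult'[symmetric] flip: exp_add)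
    finally show ?thesis .
  qed
  have "risk \<nu> (asym_normal_density \<phi>) n (\<lambda>(z, x). w z x) \<mu> \<sigma> h = (\<integral>\<^sup>+ z. ennreal (d (w z)) \<partial>?P)"
    unfolding risk_def
  proof (intro nn_integral_cong)
    fix z
    have "w z \<in> \<U>" using w N by auto
    then show "L2_dist_sq \<nu> h \<mu> (\<lambda>x. case (z, x) of (z, x) \<Rightarrow> w z x) = ennreal (d (w z))"
      using L2_dist_sq_U[OF h \<mu>] by (simp add: d_def)
  qed
  also have "\<dots> \<le> (\<integral>\<^sup>+ z. ennreal b * (ennreal (T + l) + (ennreal (?E z) + (\<Sum>u\<in>N. ennreal (?F u z)))) \<partial>?P)"
  proof (rule nn_integral_mono)
    fix z
    have "ennreal (d (w z)) \<le> ennreal (b * ((T + l) + (?E z + (\<Sum>u\<in>N. ?F u z))))"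
      by (intro ennreal_leI pw)
    also have "\<dots> = ennreal b * (ennreal (T + l) + (ennreal (?E z) + (\<Sum>u\<in>N. ennreal (?F u z))))"
      using b0 T0 l0 by (simp add: ennreal_mult' sum_nonneg sum_ennreal del: ennreal_plus add: ennreal_plus[of "T + l"] ennreal_plus[of "?E z"])
    finally show "ennreal (d (w z)) \<le> \<dots>" .
  qed
  also have "\<dots> = ennreal b * (ennreal (T + l) + ((\<integral>\<^sup>+ z. ennreal (?E z) \<partial>?P) + (\<Sum>u\<in>N. \<integral>\<^sup>+ z. ennreal (?F u z) \<partial>?P)))"
  proof -
    have E_meas: "(\<lambda>z. ennreal (?E z)) \<in> borel_measurable ?P"
      using meas[OF v] by measurable
    have F_meas: "(\<lambda>z. ennreal (?F u z)) \<in> borel_measurable ?P" if "u \<in> N" for u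
      using meas[OF that] by measurable
    then have sum_meas: "(\<lambda>z. \<Sum>u\<in>N. ennreal (?F u z)) \<in> borel_measurable ?P"
      by (intro borel_measurable_sum) auto
    have sum: "(\<integral>\<^sup>+ z. (\<Sum>u\<in>N. ennreal (?F u z)) \<partial>?P) = (\<Sum>u\<in>N. \<integral>\<^sup>+ z. ennreal (?F u z) \<partial>?P)"
      using F_meas by (rule nn_integral_sum)
    have "(\<integral>\<^sup>+ z. k * (a + (f z + g z)) \<partial>?P) = k * (a + (integral\<^sup>N ?P f + integral\<^sup>N ?P g))"
      if [measurable]: "f \<in> borel_measurable ?P" "g \<in> borel_measurable ?P" for k a f g
      by (simp add: nn_integral_cmult nn_integral_add P.emeasure_space_1)
    from this[OF E_meas sum_meas] show ?thesis by (simp only: sum)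
  qed
  \<comment> \<open>\<open>?E\<close> has mean at most 1, and so has the sum of the
    \<open>?F u\<close>; together they are the 2 in the rate.\<close>
  also have "\<dots> \<le> ennreal b * (ennreal (T + l) + (1 + (\<Sum>u\<in>N. ennreal (exp (- l)))))"
    by (intro mult_left_mono add_left_mono add_mono sum_mono E F) auto
  also have "(\<Sum>u\<in>N. ennreal (exp (- l))) = 1"
    using L by (simp add: l0 ennreal_of_nat_eq_real_of_nat ennreal_mult'[symmetric])
  also have "ennreal b * (ennreal (T + l) + (1 + 1)) = ennreal (b * ((T + l) + 2))"
    using b0 T0 l0 by (simp add: ennreal_mult' ennreal_plus[of "T + l"] del: ennreal_plus)
  also have "b * ((T + l) + 2) = (K1 * (L2_dist \<nu> h \<mu> v)\<^sup>2 + (2 + ln (real (card N))) / real n) / c"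
    using n c by (simp add: b_def T_def l_def d_def field_simps)
  finally show ?thesis .
qed

theorem minimax_risk_upper_bound:
  obtains K where "0 \<le> K"
    and "\<And>n N e. 0 < n \<Longrightarrow> finite N \<Longrightarrow> N \<noteq> {} \<Longrightarrow> N \<subseteq> \<U> \<Longrightarrow> 0 \<le> e \<Longrightarrow>
      (\<And>\<mu>. \<mu> \<in> \<U> \<Longrightarrow> \<exists>u\<in>N. L2_dist \<nu> h\<^sub>0 \<mu> u \<le> e) \<Longrightarrow>
      minimax_risk \<nu> (asym_normal_density \<phi>) \<U> \<S> \<H> n
        \<le> ennreal (K * (e\<^sup>2 + (2 + ln (real (card N))) / real n))"
proof -
  define m where "m = min \<phi> (1 - \<phi>)"
  have m: "0 < m" "m \<le> 1" using phi by (auto simp: m_def)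
  have "0 \<le> 2 * B" "0 \<le> sbar" using B0 sbar by simp_all
  from asym_sq_exp_moment[OF phi this] obtain K where K: "0 \<le> K"
    "\<And>t d s. \<bar>t\<bar> \<le> 1 \<Longrightarrow> \<bar>d\<bar> \<le> 2 * B \<Longrightarrow> 0 < s \<Longrightarrow> s \<le> sbar \<Longrightarrow>
      (\<integral>\<^sup>+ e. ennreal (exp (t * (asym_sq \<phi> (s * e + d) - asym_sq \<phi> (s * e)))) \<partial>asym_normal \<phi>)
        \<le> ennreal (1 + (max t (m * t) + t\<^sup>2 * K) * d\<^sup>2)" unfolding m_def by blast
  \<comment> \<open>At exponent - tau the coefficient is - m tau + tau^2 K. Half of m tau survives
    if tau K <= m / 2, hence the summand 2 K / m; the summand (2 B)^2 gives c (2 B)^2 <= 1, which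
    keeps 1 - c d^2 nonnegative. Both follow from tau a <= 1.\<close>
  define a where "a = 2 * K / m + (2 * B)\<^sup>2"
  define \<tau> where "\<tau> = 1 / (1 + a)"
  have a: "0 \<le> a" using K m by (simp add: a_def)
  have \<tau>: "0 < \<tau>" "\<tau> \<le> 1" using a by (auto simp: \<tau>_def)
  have \<tau>a: "\<tau> * a \<le> 1" using a by (simp add: \<tau>_def)
  have \<tau>K: "\<tau> * K \<le> m / 2"
  proof -
    have "\<tau> * (2 * K / m) \<le> \<tau> * a" using \<tau> by (intro mult_left_mono) (auto simp: a_def)
    then have "\<tau> * (2 * K / m) \<le> 1" using \<tau>a by linarith
    then show ?thesis using m by (simp add: field_simps)
  qed
  define c where "c = \<tau> * m / 2"
  have c: "0 < c" using \<tau> m by (simp add: c_def)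
  have cB: "0 \<le> 1 + (- c) * (2 * B)\<^sup>2"
  proof -
    have "c * (2 * B)\<^sup>2 = \<tau> * (2 * B)\<^sup>2 * (m / 2)" by (simp add: c_def)
    also have "\<dots> \<le> \<tau> * a * 1"
      using m \<tau> a K by (intro mult_mono) (auto simp: a_def)
    finally show ?thesis using \<tau>a by simp
  qed
  have pos: "(\<integral>\<^sup>+ e. ennreal (exp (1 * (asym_sq \<phi> (s * e + d) - asym_sq \<phi> (s * e)))) \<partial>asym_normal \<phi>)
      \<le> ennreal (1 + (1 + K) * d\<^sup>2)" if "\<bar>d\<bar> \<le> 2 * B" "0 < s" "s \<le> sbar" for d s
    using K(2)[of 1 d s] that m by (simp add: max_absorb1)
  have neg: "(\<integral>\<^sup>+ e. ennreal (exp (- \<tau> * (asym_sq \<phi> (s * e + d) - asym_sq \<phi> (s * e)))) \<partial>asym_normal \<phi>)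
      \<le> ennreal (1 + (- c) * d\<^sup>2)" if "\<bar>d\<bar> \<le> 2 * B" "0 < s" "s \<le> sbar" for d s
  proof -
    have "max (- \<tau>) (m * - \<tau>) = - (m * \<tau>)" using m \<tau> by (simp add: max_def)
    moreover have "\<tau>\<^sup>2 * K \<le> \<tau> * (m / 2)"
      using mult_left_mono[OF \<tau>K, of \<tau>] \<tau> by (simp add: power2_eq_square mult.assoc)
    ultimately have "max (- \<tau>) (m * - \<tau>) + (- \<tau>)\<^sup>2 * K \<le> - c" by (simp add: c_def mult.commute)
    then have "ennreal (1 + (max (- \<tau>) (m * - \<tau>) + (- \<tau>)\<^sup>2 * K) * d\<^sup>2) \<le> ennreal (1 + (- c) * d\<^sup>2)"
      by (intro ennreal_leI add_left_mono mult_right_mono) auto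
    moreover have "\<bar>- \<tau>\<bar> \<le> 1" using \<tau> by simp
    ultimately show ?thesis using K(2)[OF _ that, of "- \<tau>"] by (blast intro: order.trans)
  qed
  show thesis
  \<comment> \<open>\<open>C\<close> converts the approximation error under h to that under
    \<open>h\<^sub>0\<close>, the added 1 covers the stochastic term, and the division by c comes
    from \<open>minimizer_risk\<close>.\<close>
  proof (rule that[of "((1 + K) * C + 1) / c"])
    show "0 \<le> ((1 + K) * C + 1) / c" using K C0 c by simp
    fix n :: nat and N :: "('a \<Rightarrow> real) set" and e :: real
    assume n: "0 < n" and N: "finite N" "N \<noteq> {}" "N \<subseteq> \<U>" and e: "0 \<le> e"
      and cover: "\<And>\<mu>. \<mu> \<in> \<U> \<Longrightarrow> \<exists>u\<in>N. L2_dist \<nu> h\<^sub>0 \<mu> u \<le> e"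
    obtain w where w: "\<And>z. w z \<in> N"
      "\<And>\<mu> u z. u \<in> N \<Longrightarrow> excess_loss n \<mu> (w z) z \<le> excess_loss n \<mu> u z"
      and est: "(\<lambda>(z, x). w z x) \<in> estimators \<nu> n"
      using empirical_risk_minimizer[OF N, of n] by blast
    let ?rate = "e\<^sup>2 + (2 + ln (real (card N))) / real n"
    have "risk \<nu> (asym_normal_density \<phi>) n (\<lambda>(z, x). w z x) \<mu> \<sigma> h \<le> ennreal (((1 + K) * C + 1) / c * ?rate)"
      if \<mu>: "\<mu> \<in> \<U>" and \<sigma>: "\<sigma> \<in> \<S>" and h: "h \<in> \<H>" for \<mu> \<sigma> h
    proof -
      obtain v where v: "v \<in> N" "L2_dist \<nu> h\<^sub>0 \<mu> v \<le> e" using cover[OF \<mu>] by auto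
      have vU: "v \<in> \<U>" using v N by auto
      have "risk \<nu> (asym_normal_density \<phi>) n (\<lambda>(z, x). w z x) \<mu> \<sigma> h
          \<le> ennreal (((1 + K) * (L2_dist \<nu> h \<mu> v)\<^sup>2 + (2 + ln (real (card N))) / real n) / c)"
      proof (rule minimizer_risk[OF _ \<tau> c n _ _ N(1,3) v(1) \<mu> \<sigma> h])
        show "0 \<le> 1 + K" using K by simp
        fix u assume u: "u \<in> N"
        then have uU: "u \<in> \<U>" using N by auto
        show "(\<integral>\<^sup>+ z. ennreal (exp (excess_loss n \<mu> u z)) \<partial>(\<Pi>\<^sub>M i\<in>{..<n}. law \<mu> \<sigma> h))
            \<le> ennreal (exp (real n * ((1 + K) * (L2_dist \<nu> h \<mu> u)\<^sup>2)))"
          using excess_loss_exp_moment[OF pos _ \<mu> uU \<sigma> h, of n] K by simp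
        show "(\<integral>\<^sup>+ z. ennreal (exp (- \<tau> * excess_loss n \<mu> u z)) \<partial>(\<Pi>\<^sub>M i\<in>{..<n}. law \<mu> \<sigma> h))
            \<le> ennreal (exp (real n * (- c * (L2_dist \<nu> h \<mu> u)\<^sup>2)))"
          by (rule excess_loss_exp_moment[OF neg cB \<mu> uU \<sigma> h])
      qed (use w v in auto)
      also have "\<dots> \<le> ennreal (((1 + K) * C + 1) / c * ?rate)"
      proof (rule ennreal_leI)
        have "(L2_dist \<nu> h\<^sub>0 \<mu> v)\<^sup>2 \<le> e\<^sup>2" using v by (intro power_mono) (auto simp: L2_dist_def)
        then have "C * (L2_dist \<nu> h\<^sub>0 \<mu> v)\<^sup>2 \<le> C * e\<^sup>2" using C0 by (intro mult_left_mono)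
        then have "(L2_dist \<nu> h \<mu> v)\<^sup>2 \<le> C * e\<^sup>2" using L2_dist_ratio[OF h \<mu> vU] by linarith
        then have 1: "(1 + K) * (L2_dist \<nu> h \<mu> v)\<^sup>2 \<le> (1 + K) * (C * e\<^sup>2)"
          using K by (intro mult_left_mono) auto
        define y where "y = (2 + ln (real (card N))) / real n"
        have "0 < card N" using N by (simp add: card_gt_0_iff)
        then have y: "0 \<le> y" by (simp add: y_def)
        have "0 \<le> (1 + K) * C * y" using K C0 y by simp
        moreover have "((1 + K) * C + 1) * (e\<^sup>2 + y) = (1 + K) * (C * e\<^sup>2) + e\<^sup>2 + (1 + K) * C * y + y"
          by (simp add: algebra_simps)
        ultimately have "(1 + K) * (L2_dist \<nu> h \<mu> v)\<^sup>2 + y \<le> ((1 + K) * C + 1) * (e\<^sup>2 + y)"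
          using 1 zero_le_power2[of e] by linarith
        then have "((1 + K) * (L2_dist \<nu> h \<mu> v)\<^sup>2 + y) / c \<le> ((1 + K) * C + 1) * (e\<^sup>2 + y) / c"
          using c by (intro divide_right_mono) auto
        then show "((1 + K) * (L2_dist \<nu> h \<mu> v)\<^sup>2 + (2 + ln (real (card N))) / real n) / c
            \<le> ((1 + K) * C + 1) / c * ?rate" by (simp add: y_def)
      qed
      finally show ?thesis .
    qed
    then show "minimax_risk \<nu> (asym_normal_density \<phi>) \<U> \<S> \<H> n \<le> ennreal (((1 + K) * C + 1) / c * ?rate)"
      unfolding minimax_risk_def by (intro INF_lower2[OF est] SUP_least) auto
  qed
qed

end

section \<open>Metric entropy and the rate\<close>

lemma packing_entropy_antimono:
  assumes "e \<le> e'"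
  shows "packing_entropy \<nu> h \<G> e' \<le> packing_entropy \<nu> h \<G> e"
  unfolding packing_entropy_def
proof (rule SUP_subset_mono)
  show "{N. packing_set \<nu> h \<G> e' N} \<subseteq> {N. packing_set \<nu> h \<G> e N}"
    using assms unfolding packing_set_def by (auto intro: order.strict_trans1)
qed simp

lemma packing_set_le_entropy:
  assumes "packing_entropy \<nu> h \<G> e < \<infinity>" "packing_set \<nu> h \<G> e N"
  shows "ln (real (card N)) \<le> enn2real (packing_entropy \<nu> h \<G> e)"
proof -
  have "ennreal (ln (real (card N))) \<le> packing_entropy \<nu> h \<G> e"
    unfolding packing_entropy_def using assms(2) by (intro SUP_upper) simp
  then have "enn2real (ennreal (ln (real (card N)))) \<le> enn2real (packing_entropy \<nu> h \<G> e)"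
    using assms(1) by (intro enn2real_mono) auto
  moreover have "0 \<le> ln (real (card N))" by (cases "card N = 0") auto
  ultimately show ?thesis by simp
qed

text \<open>The supremum need not be attained, hence the strict gap. Finiteness is implicit: an
  infinite entropy has \<open>enn2real\<close> 0, which is not above b.\<close>

lemma packing_set_near_entropy:
  assumes "0 \<le> b" "b < enn2real (packing_entropy \<nu> h \<G> e)"
  obtains N where "packing_set \<nu> h \<G> e N" "b < ln (real (card N))"
proof -
  have "packing_entropy \<nu> h \<G> e \<noteq> top" using assms by auto
  then have "ennreal (enn2real (packing_entropy \<nu> h \<G> e)) = packing_entropy \<nu> h \<G> e"
    by (simp add: ennreal_enn2real_if)
  then have "ennreal b < packing_entropy \<nu> h \<G> e"
    using assms ennreal_less_iff[OF assms(1), of "enn2real (packing_entropy \<nu> h \<G> e)"] by simp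
  then obtain N where "packing_set \<nu> h \<G> e N" "ennreal b < ennreal (ln (real (card N)))"
    unfolding packing_entropy_def less_SUP_iff by auto
  then show thesis using assms(1) that by (simp add: ennreal_less_iff)
qed

text \<open>Finite entropy bounds the cardinalities, so a packing of largest cardinality exists. A
  point farther than e from all of it could be added, so it is also a net.\<close>

lemma maximal_packing_set:
  assumes fin: "packing_entropy \<nu> h \<G> e < \<infinity>" and "\<G> \<noteq> {}" and e: "0 \<le> e"
  obtains N where "packing_set \<nu> h \<G> e N" "N \<noteq> {}" "\<And>g. g \<in> \<G> \<Longrightarrow> \<exists>u\<in>N. L2_dist \<nu> h g u \<le> e"
proof -
  have commute: "L2_dist \<nu> h g g' = L2_dist \<nu> h g' g" for g g'
    unfolding L2_dist_def by (simp add: L2_dist_sq_commute)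
  have refl: "L2_dist \<nu> h g g = 0" for g by (simp add: L2_dist_def L2_dist_sq_def)
  define b where "b = nat \<lceil>exp (enn2real (packing_entropy \<nu> h \<G> e))\<rceil>"
  have bound: "card N < Suc b" if "packing_set \<nu> h \<G> e N" for N
  proof (cases "card N = 0")
    case False
    then have "real (card N) = exp (ln (real (card N)))" by simp
    also have "\<dots> \<le> exp (enn2real (packing_entropy \<nu> h \<G> e))"
      using packing_set_le_entropy[OF fin that] by simp
    finally have "real (card N) \<le> real b" unfolding b_def by linarith
    then show ?thesis by simp
  qed simp
  have "packing_set \<nu> h \<G> e {}" by (simp add: packing_set_def)
  moreover have "\<forall>N. packing_set \<nu> h \<G> e N \<longrightarrow> card N < Suc b"
    using bound by blast
  ultimately have "\<exists>N. packing_set \<nu> h \<G> e N \<and> (\<forall>N'. packing_set \<nu> h \<G> e N' \<longrightarrow> card N' \<le> card N)"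
    by (rule ex_has_greatest_nat)
  then obtain N where N: "packing_set \<nu> h \<G> e N"
    and max: "\<And>N'. packing_set \<nu> h \<G> e N' \<Longrightarrow> card N' \<le> card N" by blast
  have finN: "finite N" using N by (simp add: packing_set_def)
  have cover: "\<exists>u\<in>N. L2_dist \<nu> h g u \<le> e" if g: "g \<in> \<G>" for g
  proof (rule ccontr)
    assume "\<not> ?thesis"
    then have far: "e < L2_dist \<nu> h g u \<and> e < L2_dist \<nu> h u g" if "u \<in> N" for u
      using that commute[of g u] by auto
    then have "g \<notin> N" using refl e by force
    moreover have "packing_set \<nu> h \<G> e (insert g N)"
      using N g far unfolding packing_set_def by auto
    ultimately show False using max[of "insert g N"] finN by simp
  qed
  then have "N \<noteq> {}" using \<open>\<G> \<noteq> {}\<close> by blast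
  with N cover show thesis using that by blast
qed

text \<open>Any y strictly between 1 and the lower limit works. A zero of M is excluded since
  division by 0 gives 0 < y. Absolute values appear because the order of the entropy controls only
  |M|.\<close>

lemma rich_growth:
  assumes "rich M"
  obtains \<alpha> y where "0 < \<alpha>" "\<alpha> < 1" "1 < (y::real)"
    and "\<forall>\<^sub>F e in at_right 0. M e \<noteq> 0 \<and> y * \<bar>M e\<bar> \<le> \<bar>M (\<alpha> * e)\<bar>"
proof -
  obtain \<alpha> where \<alpha>: "0 < \<alpha>" "\<alpha> < 1" and "1 < Liminf (at_right 0) (\<lambda>e. ereal (M (\<alpha> * e) / M e))"
    using assms by (auto simp: rich_def)
  then obtain y where y: "1 < ereal y" "ereal y < Liminf (at_right 0) (\<lambda>e. ereal (M (\<alpha> * e) / M e))"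
    using ereal_dense2 by blast
  have y1: "1 < y" using y(1) by simp
  have "\<forall>\<^sub>F e in at_right 0. ereal y < ereal (M (\<alpha> * e) / M e)" by (rule less_LiminfD[OF y(2)])
  then have "\<forall>\<^sub>F e in at_right 0. M e \<noteq> 0 \<and> y * \<bar>M e\<bar> \<le> \<bar>M (\<alpha> * e)\<bar>"
  proof eventually_elim
    case (elim e)
    then have q: "y < M (\<alpha> * e) / M e" by simp
    then have M: "M e \<noteq> 0" using y1 by auto
    have "y \<le> \<bar>M (\<alpha> * e) / M e\<bar>" using q by linarith
    then have "y \<le> \<bar>M (\<alpha> * e)\<bar> / \<bar>M e\<bar>" by (simp add: abs_divide)
    then have "y * \<bar>M e\<bar> \<le> \<bar>M (\<alpha> * e)\<bar>" using M by (simp add: pos_le_divide_eq)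
    with M show ?case by simp
  qed
  with \<alpha> y1 that show thesis by blast
qed

text \<open>A factor alpha^k in the radius multiplies |M| by at least y^k, so some k independent of
  e overtakes A. The floor \<open>t\<^sub>0\<close> comes from monotonicity of the entropy; it lets
  additive constants be absorbed into |M e|.\<close>

lemma entropy_growth:
  assumes H: "(\<lambda>e. enn2real (packing_entropy \<nu> h \<G> e)) \<in> \<Theta>[at_right 0](M)" and M: "rich M"
  obtains e\<^sub>0 \<alpha> c t\<^sub>0 where "0 < (e\<^sub>0::real)" "0 < \<alpha>" "\<alpha> < 1" "0 < c" "0 < (t\<^sub>0::real)" "\<G> \<noteq> {}"
    and "\<And>e. 0 < e \<Longrightarrow> e < e\<^sub>0 \<Longrightarrow> packing_entropy \<nu> h \<G> e < \<infinity>"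
    and "\<And>e. 0 < e \<Longrightarrow> e < e\<^sub>0 \<Longrightarrow> enn2real (packing_entropy \<nu> h \<G> e) \<le> c * \<bar>M e\<bar>"
    and "\<And>e. 0 < e \<Longrightarrow> e < e\<^sub>0 \<Longrightarrow> t\<^sub>0 \<le> \<bar>M e\<bar>"
    and "\<And>A. \<exists>k. \<forall>e. 0 < e \<longrightarrow> e < e\<^sub>0 \<longrightarrow> A * \<bar>M e\<bar> < enn2real (packing_entropy \<nu> h \<G> (\<alpha> ^ k * e))"
proof -
  let ?H = "\<lambda>e. enn2real (packing_entropy \<nu> h \<G> e)"
  obtain \<alpha> y where \<alpha>: "0 < \<alpha>" "\<alpha> < 1" and y: "1 < (y::real)"
    and growth: "\<forall>\<^sub>F e in at_right 0. M e \<noteq> 0 \<and> y * \<bar>M e\<bar> \<le> \<bar>M (\<alpha> * e)\<bar>"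
    by (rule rich_growth[OF M])
  obtain c where c: "0 < c" "\<forall>\<^sub>F e in at_right 0. norm (?H e) \<le> c * norm (M e)"
    by (rule landau_o.bigE[OF bigthetaD1[OF H]])
  obtain c' where c': "0 < c'" "\<forall>\<^sub>F e in at_right 0. norm (?H e) \<ge> c' * norm (M e)"
    by (rule landau_omega.bigE[OF bigthetaD2[OF H]])
  have "\<forall>\<^sub>F e in at_right 0. M e \<noteq> 0 \<and> y * \<bar>M e\<bar> \<le> \<bar>M (\<alpha> * e)\<bar> \<and> ?H e \<le> c * \<bar>M e\<bar> \<and> c' * \<bar>M e\<bar> \<le> ?H e"
    using growth c(2) c'(2) by eventually_elim auto
  then obtain e\<^sub>0 where e0: "0 < e\<^sub>0" and *: "\<And>e. 0 < e \<Longrightarrow> e < e\<^sub>0 \<Longrightarrow>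
      M e \<noteq> 0 \<and> y * \<bar>M e\<bar> \<le> \<bar>M (\<alpha> * e)\<bar> \<and> ?H e \<le> c * \<bar>M e\<bar> \<and> c' * \<bar>M e\<bar> \<le> ?H e"
    unfolding eventually_at_right_field by auto
  have H_pos: "0 < ?H e" if "0 < e" "e < e\<^sub>0" for e
    using *[OF that] c'(1) by (meson mult_pos_pos zero_less_abs_iff less_le_trans)
  \<comment> \<open>\<open>enn2real\<close> sends infinity to 0, so a positive value certifies
    finiteness.\<close>
  have fin: "packing_entropy \<nu> h \<G> e < \<infinity>" if "0 < e" "e < e\<^sub>0" for e
    using H_pos[OF that] by (cases "packing_entropy \<nu> h \<G> e") auto
  \<comment> \<open>Halving makes \<open>e\<^sub>1\<close> itself a radius at which the estimates
    hold; the positive entropy there bounds from below that at every smaller radius.\<close>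
  define e\<^sub>1 where "e\<^sub>1 = e\<^sub>0 / 2"
  have e1: "0 < e\<^sub>1" "e\<^sub>1 < e\<^sub>0" using e0 by (auto simp: e\<^sub>1_def)
  \<comment> \<open>An empty class has only the empty packing, and \<open>ln 0 = 0\<close>.\<close>
  have ne: "\<G> \<noteq> {}"
  proof
    assume "\<G> = {}"
    then have "{N. packing_set \<nu> h \<G> e\<^sub>1 N} = {{}}" by (auto simp: packing_set_def)
    then show False using H_pos[OF e1] by (simp add: packing_entropy_def)
  qed
  have iter: "y ^ k * \<bar>M e\<bar> \<le> \<bar>M (\<alpha> ^ k * e)\<bar>" "\<alpha> ^ k * e < e\<^sub>0" "0 < \<alpha> ^ k * e" if e: "0 < e" "e < e\<^sub>0" for e k
  proof -
    show le: "\<alpha> ^ k * e < e\<^sub>0" for k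
    proof -
      have "\<alpha> ^ k * e \<le> 1 * e" using \<alpha> e by (intro mult_right_mono power_le_one) auto
      then show ?thesis using e by linarith
    qed
    show pos: "0 < \<alpha> ^ k * e" for k using \<alpha> e by simp
    show "y ^ k * \<bar>M e\<bar> \<le> \<bar>M (\<alpha> ^ k * e)\<bar>"
    proof (induction k)
      case (Suc k)
      have "y ^ Suc k * \<bar>M e\<bar> \<le> y * \<bar>M (\<alpha> ^ k * e)\<bar>"
        using Suc y by (simp add: mult.assoc)
      also have "\<dots> \<le> \<bar>M (\<alpha> * (\<alpha> ^ k * e))\<bar>" using *[OF pos le] by blast
      finally show ?case by (simp add: mult.assoc)
    qed simp
  qed
  show thesis
  proof (rule that[of e\<^sub>1 \<alpha> c "?H e\<^sub>1 / c"])
    show "0 < e\<^sub>1" "0 < \<alpha>" "\<alpha> < 1" "0 < c" "\<G> \<noteq> {}" by fact+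
    show "0 < ?H e\<^sub>1 / c" using H_pos[OF e1] c by simp
    fix e assume e: "0 < e" "e < e\<^sub>1"
    then have e': "0 < e" "e < e\<^sub>0" using e1 by auto
    show "packing_entropy \<nu> h \<G> e < \<infinity>" by (rule fin[OF e'])
    show "?H e \<le> c * \<bar>M e\<bar>" using *[OF e'] by blast
    have "?H e\<^sub>1 \<le> ?H e"
      using packing_entropy_antimono[of e e\<^sub>1 \<nu> h \<G>] e fin[OF e'] by (intro enn2real_mono) auto
    also have "\<dots> \<le> c * \<bar>M e\<bar>" using *[OF e'] by blast
    finally show "?H e\<^sub>1 / c \<le> \<bar>M e\<bar>" using c by (simp add: field_simps)
  next
    fix A
    obtain k where k: "A / c' < y ^ k" using real_arch_pow[OF y] by auto
    show "\<exists>k. \<forall>e. 0 < e \<longrightarrow> e < e\<^sub>1 \<longrightarrow> A * \<bar>M e\<bar> < ?H (\<alpha> ^ k * e)"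
    proof (intro exI[of _ k] allI impI)
      fix e assume "0 < e" "e < e\<^sub>1"
      then have e: "0 < e" "e < e\<^sub>0" using e1 by auto
      have "A < c' * y ^ k" using k c' by (simp add: field_simps)
      then have "A * \<bar>M e\<bar> < c' * y ^ k * \<bar>M e\<bar>" using *[OF e] by (intro mult_strict_right_mono) auto
      also have "\<dots> \<le> c' * \<bar>M (\<alpha> ^ k * e)\<bar>"
        using iter(1)[OF e, of k] c' by (simp add: mult.assoc)
      also have "\<dots> \<le> ?H (\<alpha> ^ k * e)" using *[OF iter(3,2)[OF e]] by blast
      finally show "A * \<bar>M e\<bar> < ?H (\<alpha> ^ k * e)" .
    qed
  qed
qed

text \<open>Where \<open>h\<^sub>0 x\<close> is 0, a positive \<open>h x\<close> would make the
  extended quotient infinite, so a finite \<open>C\<close> forces \<open>h x = 0\<close>.\<close>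

lemma ratio_SUP_le:
  fixes h h\<^sub>0 :: "'a \<Rightarrow> real" and C :: ennreal
  assumes C: "C < \<infinity>" "(SUP x\<in>A. ennreal (h x) / ennreal (h\<^sub>0 x)) \<le> C" and x: "x \<in> A"
    and h: "0 \<le> h x" "0 \<le> h\<^sub>0 x"
  shows "h x \<le> enn2real C * h\<^sub>0 x"
proof -
  have le: "ennreal (h x) / ennreal (h\<^sub>0 x) \<le> C" using C(2) x by (meson SUP_upper order.trans)
  have "C = ennreal (enn2real C)" using C(1) by simp
  show ?thesis
  proof (cases "h\<^sub>0 x = 0")
    case True
    then have "h x = 0"
      using le C(1) h by (cases "h x = 0") (auto simp: divide_ennreal_def ennreal_mult_top top_unique)
    then show ?thesis by (simp add: True)
  next
    case False
    then have h0: "0 < h\<^sub>0 x" using h by simp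
    have "ennreal (h x / h\<^sub>0 x) \<le> ennreal (enn2real C)"
      using le C(1) h h0 by (simp add: divide_ennreal)
    then have "h x / h\<^sub>0 x \<le> enn2real C" by (simp add: ennreal_le_iff)
    then show ?thesis using h0 by (simp add: field_simps)
  qed
qed

theorem corollary2:
  fixes \<nu> :: "'a measure"
    and \<U> \<S> \<H> :: "('a \<Rightarrow> real) set"
    and h\<^sub>0 :: "'a \<Rightarrow> real"
    and \<phi> sbar :: real
    and C :: ennreal
    and M :: "real \<Rightarrow> real"
    and \<epsilon> :: "nat \<Rightarrow> real"
  assumes "0 < \<phi>" and "\<phi> < 1"
    and "\<And>h. h \<in> \<H> \<Longrightarrow> is_density \<nu> h"
    and "\<And>\<mu>. \<mu> \<in> \<U> \<Longrightarrow> \<mu> \<in> borel_measurable \<nu>"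
    and "\<exists>B::real. \<forall>\<mu>\<in>\<U>. AE x in \<nu>. \<bar>\<mu> x\<bar> \<le> B"
    and "\<S> \<noteq> {}"
    and "\<And>\<sigma>. \<sigma> \<in> \<S> \<Longrightarrow> \<sigma> \<in> borel_measurable \<nu>"
    and "sbar > 1"
    and "\<And>\<sigma> x. \<sigma> \<in> \<S> \<Longrightarrow> x \<in> space \<nu> \<Longrightarrow> 1 / sbar \<le> \<sigma> x \<and> \<sigma> x \<le> sbar"
    and "h\<^sub>0 \<in> \<H>"
    and "C < \<infinity>"
    and "\<And>h. h \<in> \<H> \<Longrightarrow> (SUP x\<in>space \<nu>. ennreal (h x) / ennreal (h\<^sub>0 x)) \<le> C"
    and "L2_totally_bounded \<nu> h\<^sub>0 \<U>"
    and "(\<lambda>e. enn2real (packing_entropy \<nu> h\<^sub>0 \<U> e)) \<in> \<Theta>[at_right 0](M)"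
    and "rich M" and "order_regular M"
    and "\<forall>\<^sub>F e in at_right 0. packing_entropy \<nu> h\<^sub>0 \<S> e < \<infinity>"
    and "(\<lambda>e. enn2real (packing_entropy \<nu> h\<^sub>0 \<S> e))
           \<in> O[at_right 0](\<lambda>e. enn2real (packing_entropy \<nu> h\<^sub>0 \<U> e))"
    and "\<forall>\<^sub>F n in sequentially. 0 < \<epsilon> n \<and> M (\<epsilon> n) = real n * (\<epsilon> n)\<^sup>2"
    and "\<epsilon> \<longlonglongrightarrow> 0"
  shows "(\<lambda>n. enn2real (minimax_risk \<nu> (asym_normal_density \<phi>) \<U> \<S> \<H> n)) \<in> \<Theta>(\<lambda>n. (\<epsilon> n)\<^sup>2)"
proof -
  obtain B where B: "\<And>\<mu>. \<mu> \<in> \<U> \<Longrightarrow> AE x in \<nu>. \<bar>\<mu> x\<bar> \<le> B" using assms(5) by auto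
  interpret expectile_model \<nu> \<phi> \<U> \<S> \<H> h\<^sub>0 "max B 0" sbar "enn2real C"
  proof
    show "AE x in \<nu>. \<bar>\<mu> x\<bar> \<le> max B 0" if "\<mu> \<in> \<U>" for \<mu>
      using B[OF that] by eventually_elim simp
    show "h x \<le> enn2real C * h\<^sub>0 x" if "h \<in> \<H>" "x \<in> space \<nu>" for h x
      using assms(3)[OF that(1)] assms(3)[OF assms(10)] that
      by (intro ratio_SUP_le[OF assms(11,12)]) (auto simp: is_density_def)
  qed (use assms(1-4,6-10) in auto)
  let ?R = "\<lambda>n. minimax_risk \<nu> (asym_normal_density \<phi>) \<U> \<S> \<H> n"
  let ?H = "\<lambda>e. enn2real (packing_entropy \<nu> h\<^sub>0 \<U> e)"
  obtain e\<^sub>0 \<alpha> c t\<^sub>0 where e0: "0 < (e\<^sub>0::real)" and \<alpha>: "0 < \<alpha>" "\<alpha> < 1" and c: "0 < c" and t0: "0 < (t\<^sub>0::real)"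
    and ne: "\<U> \<noteq> {}"
    and fin: "\<And>e. 0 < e \<Longrightarrow> e < e\<^sub>0 \<Longrightarrow> packing_entropy \<nu> h\<^sub>0 \<U> e < \<infinity>"
    and Hle: "\<And>e. 0 < e \<Longrightarrow> e < e\<^sub>0 \<Longrightarrow> ?H e \<le> c * \<bar>M e\<bar>"
    and tM: "\<And>e. 0 < e \<Longrightarrow> e < e\<^sub>0 \<Longrightarrow> t\<^sub>0 \<le> \<bar>M e\<bar>"
    and Hge: "\<And>A. \<exists>k. \<forall>e. 0 < e \<longrightarrow> e < e\<^sub>0 \<longrightarrow> A * \<bar>M e\<bar> < ?H (\<alpha> ^ k * e)"
    by (rule entropy_growth[OF assms(14,15)]) blast
  obtain K where K: "0 \<le> K" and upper: "\<And>n N e. 0 < n \<Longrightarrow> finite N \<Longrightarrow> N \<noteq> {} \<Longrightarrow> N \<subseteq> \<U> \<Longrightarrow> 0 \<le> e \<Longrightarrow>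
      (\<And>\<mu>. \<mu> \<in> \<U> \<Longrightarrow> \<exists>u\<in>N. L2_dist \<nu> h\<^sub>0 \<mu> u \<le> e) \<Longrightarrow>
      ?R n \<le> ennreal (K * (e\<^sup>2 + (2 + ln (real (card N))) / real n))"
    by (rule minimax_risk_upper_bound) blast
  obtain \<kappa> where \<kappa>: "0 \<le> \<kappa>" and lower: "\<And>n N J \<delta> e. packing_set \<nu> h\<^sub>0 \<U> \<delta> N \<Longrightarrow> N \<noteq> {} \<Longrightarrow>
      finite J \<Longrightarrow> J \<subseteq> \<U> \<Longrightarrow> 0 < \<delta> \<Longrightarrow> (\<And>\<mu>. \<mu> \<in> N \<Longrightarrow> \<exists>u\<in>J. L2_dist \<nu> h\<^sub>0 \<mu> u \<le> e) \<Longrightarrow>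
      4 * exp (real n * \<kappa> * e\<^sup>2) * real (card J) \<le> real (card N) \<Longrightarrow> ennreal (\<delta>\<^sup>2 / 8) \<le> ?R n"
    by (rule minimax_risk_lower_bound) blast
  \<comment> \<open>With t = n e^2 = |M e| the three terms pay, in turn, for the factor 4 <= exp 3
    (as t >= \<open>t\<^sub>0\<close>), for the likelihood ratio exp (kappa t), and for a net of at
    most exp (c t) elements.\<close>
  obtain k where k: "\<And>e. 0 < e \<Longrightarrow> e < e\<^sub>0 \<Longrightarrow> (3 / t\<^sub>0 + \<kappa> + c) * \<bar>M e\<bar> < ?H (\<alpha> ^ k * e)"
    using Hge by blast
  \<comment> \<open>The packing radius is \<open>\<alpha> ^ k\<close> times the net radius, and the
    lower bound is an eighth of its square.\<close>
  define a where "a = (\<alpha> ^ k)\<^sup>2 / 8"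
  \<comment> \<open>The stochastic term splits into 2 / n <= (2 / \<open>t\<^sub>0\<close>) e^2 and
    ln (card J) / n <= c e^2; the final 1 keeps b positive when K = 0.\<close>
  define b where "b = K * (1 + 2 / t\<^sub>0 + c) + 1"
  have a: "0 < a" using \<alpha> by (simp add: a_def)
  have b0: "0 < b" using K t0 c unfolding b_def by (intro add_nonneg_pos mult_nonneg_nonneg) auto
  have "\<forall>\<^sub>F n in sequentially. \<epsilon> n < e\<^sub>0" using assms(20) e0 by (rule order_tendstoD)
  with assms(19) eventually_gt_at_top[of 0]
  have bounds: "\<forall>\<^sub>F n in sequentially. a * (\<epsilon> n)\<^sup>2 \<le> enn2real (?R n) \<and> enn2real (?R n) \<le> b * (\<epsilon> n)\<^sup>2"
  proof eventually_elim
    case (elim n)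
    define e where "e = \<epsilon> n"
    define t where "t = real n * e\<^sup>2"
    have n: "0 < n" and e: "0 < e" "e < e\<^sub>0" and M: "\<bar>M e\<bar> = t" using elim by (auto simp: e_def t_def)
    have t: "t\<^sub>0 \<le> t" "0 < t" using tM[OF e] M t0 by auto
    \<comment> \<open>One net serves both bounds: as the candidates of the estimator and as the
      cover of the finer packing.\<close>
    obtain J where J: "packing_set \<nu> h\<^sub>0 \<U> e J" "J \<noteq> {}"
      and cover: "\<And>g. g \<in> \<U> \<Longrightarrow> \<exists>u\<in>J. L2_dist \<nu> h\<^sub>0 g u \<le> e"
      by (rule maximal_packing_set[OF fin[OF e] ne less_imp_le[OF e(1)]]) blast
    have J': "finite J" "J \<subseteq> \<U>" using J by (auto simp: packing_set_def)
    have lnJ: "ln (real (card J)) \<le> c * t"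
      using packing_set_le_entropy[OF fin[OF e] J(1)] Hle[OF e] M by simp
    have cardJ: "0 < real (card J)" using J J' by (simp add: card_gt_0_iff)
    have "?R n \<le> ennreal (K * (e\<^sup>2 + (2 + ln (real (card J))) / real n))"
      by (rule upper[OF n J'(1) J(2) J'(2) less_imp_le[OF e(1)] cover])
    also have "\<dots> \<le> ennreal (b * e\<^sup>2)"
    proof (rule ennreal_leI)
      have "2 \<le> 2 / t\<^sub>0 * t" using t t0 by (simp add: field_simps)
      then have "(2 + ln (real (card J))) / real n \<le> (2 / t\<^sub>0 * t + c * t) / real n"
        using lnJ by (intro divide_right_mono) auto
      also have "\<dots> = (2 / t\<^sub>0 + c) * e\<^sup>2" using n by (simp add: t_def field_simps)
      finally have "K * (e\<^sup>2 + (2 + ln (real (card J))) / real n) \<le> K * (e\<^sup>2 + (2 / t\<^sub>0 + c) * e\<^sup>2)"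
        using K by (intro mult_left_mono add_left_mono)
      also have "\<dots> \<le> b * e\<^sup>2" by (simp add: b_def algebra_simps)
      finally show "K * (e\<^sup>2 + (2 + ln (real (card J))) / real n) \<le> b * e\<^sup>2" .
    qed
    finally have up: "?R n \<le> ennreal (b * e\<^sup>2)" .
    have low: "ennreal (a * e\<^sup>2) \<le> ?R n"
    proof -
      have "3 \<le> 3 / t\<^sub>0 * t" using t t0 by (simp add: field_simps)
      then have "3 + \<kappa> * t + c * t < ?H (\<alpha> ^ k * e)"
        using k[OF e] by (simp add: M algebra_simps)
      moreover have "0 \<le> 3 + \<kappa> * t + c * t" using \<kappa> c t by simp
      ultimately obtain N where N: "packing_set \<nu> h\<^sub>0 \<U> (\<alpha> ^ k * e) N"
        and lnN: "3 + \<kappa> * t + c * t < ln (real (card N))"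
        using packing_set_near_entropy by blast
      have cardN: "0 < card N"
        using lnN \<open>0 \<le> 3 + \<kappa> * t + c * t\<close> by (cases "card N = 0") auto
      have "exp (ln (real (card J))) \<le> exp (c * t)" using lnJ by simp
      then have "real (card J) \<le> exp (c * t)" using cardJ by simp
      moreover have "4 \<le> exp (3::real)" using exp_ge_add_one_self[of 3] by simp
      ultimately have "4 * exp (\<kappa> * t) * real (card J) \<le> exp 3 * exp (\<kappa> * t) * exp (c * t)"
        by (intro mult_mono) auto
      also have "\<dots> = exp (3 + \<kappa> * t + c * t)" by (simp add: exp_add)
      also have "\<dots> \<le> exp (ln (real (card N)))" using lnN by simp
      also have "\<dots> = real (card N)" using cardN by simp
      finally have card: "4 * exp (real n * \<kappa> * e\<^sup>2) * real (card J) \<le> real (card N)"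
        by (simp add: t_def mult_ac)
      have "ennreal ((\<alpha> ^ k * e)\<^sup>2 / 8) \<le> ?R n"
      proof (rule lower[OF N _ J' _ _ card])
        show "N \<noteq> {}" using cardN by auto
        show "0 < \<alpha> ^ k * e" using \<alpha> e by simp
        show "\<exists>u\<in>J. L2_dist \<nu> h\<^sub>0 \<mu> u \<le> e" if "\<mu> \<in> N" for \<mu>
          using N that by (intro cover) (auto simp: packing_set_def)
      qed
      then show ?thesis by (simp add: a_def power_mult_distrib)
    qed
    \<comment> \<open>Finiteness makes \<open>enn2real\<close> monotone at the risk, so both bounds
      carry over to the reals.\<close>
    have fin_R: "?R n < top" using up by (rule le_less_trans) simp
    have "enn2real (ennreal (a * e\<^sup>2)) \<le> enn2real (?R n)" "enn2real (?R n) \<le> enn2real (ennreal (b * e\<^sup>2))"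
      using low up fin_R by (auto intro!: enn2real_mono)
    then show ?case using a b0 by (simp add: e_def)
  qed
  show ?thesis
  proof (rule bigthetaI)
    show "(\<lambda>n. enn2real (?R n)) \<in> O(\<lambda>n. (\<epsilon> n)\<^sup>2)"
      using bounds b0 by (intro landau_o.bigI[where c=b]) (auto elim!: eventually_mono)
    show "(\<lambda>n. enn2real (?R n)) \<in> \<Omega>(\<lambda>n. (\<epsilon> n)\<^sup>2)"
      using bounds a by (intro landau_omega.bigI[where c=a]) (auto elim!: eventually_mono)
  qed
qed

end
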